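(* Let $A_nx^{(n)}=y^{(n)}$ be given, where $A_n$ is an $n\times n$ hermitian positive definite Toeplitz matrix with $(A_n)_{kl}=a_{k-l}$ and $$a_k=\int_{-1/2}^{1/2}f(\omega)e^{2\pi i\omega k}\,d\omega .$$ Assume that $|a_k|\le c\,e^{-\gamma|k|}$ and $|(y^{(n)})_k|\le c'\,e^{-\gamma|n/2-k|}$. Suppose that the $2n\times2n$ circulant embedding $C_{2n}$ of $A_n$ (defined in the context) is invertible, and let $z^{(n)}$ be the solution of $S_nz^{(n)}=y^{(n)}$, where $S_n$ is the inverse of the $n\times n$ leading principal submatrix of $C_{2n}^{-1}$. Then there exist a $\gamma_1$ with $0<\gamma_1<\gamma$ and a constant $c_1$ depending only on $f_{\min}$, $f_{\max}$ and $\gamma_1$ such that $$\|x^{(n)}-z^{(n)}\|\le c_1\,e^{-\gamma_1 n}.$$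
   Context: The function $f$ is $1$-periodic, continuous and real-valued; $f_{\min}$ and $f_{\max}$ denote its minimum and maximum. The matrix $A_n$ is regarded as a finite section of the biinfinite hermitian positive definite Toeplitz matrix $L=(a_{k-l})_{k,l\in\mathbb Z}$ with defining function $f$ (so $f_{\min}>0$), and $\gamma>0$, $c$, $c'$ are constants. The entries of $y^{(n)}\in\mathbb C^n$ are indexed by $k=0,\dots,n-1$, and $\|\cdot\|$ is the Euclidean norm. The circulant embedding of $A_n$ is $$C_{2n}=\begin{bmatrix}A_n & B_n^*\\ B_n & A_n\end{bmatrix},$$ where $B_n$ is the $n\times n$ Toeplitz matrix whose first row is $(b_0,b_1,\dots,b_{n-1})$ with $b_k=a_{n-k}$ for $k=1,\dots,n-1$, and with $b_0=a_n$ if $a_n$ is known and $b_0=0$ otherwise; the remaining entries of $B_n$ are those that make $C_{2n}$ circulant, i.e. the first column of $B_n$ is $(b_0,\overline{a_{n-1}},\dots,\overline{a_1})^T$. When $C_{2n}$ is invertible, the leading principal $n\times n$ submatrix $M_n$ of $C_{2n}^{-1}$ is invertible, and $S_n=M_n^{-1}=A_n-B_nA_n^{-1}B_n^*$. *)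

theory Defs
  imports
    "HOL-Analysis.Analysis"
    "Jordan_Normal_Form.Gauss_Jordan_Elimination"
    "Jordan_Normal_Form.Schur_Decomposition"
begin

(* Both HOL-Analysis and Jordan_Normal_Form use $ for vector components; here it is the
   latter, whose vectors and matrices carry their dimension as a value. *)
unbundle no vec_syntax

(* For continuous periodic f these are attained, i.e. they are the minimum and the maximum. *)
definition f_min :: "(real \<Rightarrow> real) \<Rightarrow> real" where
  "f_min f = Inf (range f)"

definition f_max :: "(real \<Rightarrow> real) \<Rightarrow> real" where
  "f_max f = Sup (range f)"

definition toeplitz_coeff :: "(real \<Rightarrow> real) \<Rightarrow> int \<Rightarrow> complex" where
  "toeplitz_coeff f k =
     integral {-1/2..1/2} (\<lambda>\<omega>. of_real (f \<omega>) * exp (2 * of_real pi * \<i> * of_real \<omega> * of_int k))"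

definition toeplitz_mat :: "(int \<Rightarrow> complex) \<Rightarrow> nat \<Rightarrow> complex mat" where
  "toeplitz_mat a n = mat n n (\<lambda>(k, l). a (int k - int l))"

definition hermitian_pos_def :: "complex mat \<Rightarrow> bool" where
  "hermitian_pos_def A \<longleftrightarrow>
     square_mat A \<and> mat_adjoint A = A \<and>
     (\<forall>v \<in> carrier_vec (dim_row A). v \<noteq> 0\<^sub>v (dim_row A) \<longrightarrow> 0 < Re ((A *\<^sub>v v) \<bullet>c v))"

(* The Toeplitz matrix with first row (b0, a_(n-1), ..., a_1) and
   first column (b0, cnj a_(n-1), ..., cnj a_1). *)
definition corner_mat :: "(int \<Rightarrow> complex) \<Rightarrow> nat \<Rightarrow> complex \<Rightarrow> complex mat" where
  "corner_mat a n b0 = mat n n (\<lambda>(k, l).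
     if k = l then b0
     else if k < l then a (int n - (int l - int k))
     else cnj (a (int n - (int k - int l))))"

definition circulant_embedding :: "(int \<Rightarrow> complex) \<Rightarrow> nat \<Rightarrow> complex \<Rightarrow> complex mat" where
  "circulant_embedding a n b0 =
     four_block_mat (toeplitz_mat a n) (mat_adjoint (corner_mat a n b0))
                    (corner_mat a n b0) (toeplitz_mat a n)"

definition leading_principal :: "nat \<Rightarrow> 'a mat \<Rightarrow> 'a mat" where
  "leading_principal n A = mat n n (\<lambda>(i, j). A $$ (i, j))"

(* Meaningful for invertible A only: mat_inverse returns None otherwise. *)
definition inv_mat :: "'a :: field mat \<Rightarrow> 'a mat" where
  "inv_mat A = the (mat_inverse A)"

definition S_mat :: "(int \<Rightarrow> complex) \<Rightarrow> nat \<Rightarrow> complex \<Rightarrow> complex mat" where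
  "S_mat a n b0 = inv_mat (leading_principal n (inv_mat (circulant_embedding a n b0)))"

definition vec_norm2 :: "complex vec \<Rightarrow> real" where
  "vec_norm2 v = L2_set (\<lambda>k. cmod (v $ k)) {..<dim_vec v}"

lemma inv_mat:
  fixes A :: "'a :: field mat"
  assumes A: "A \<in> carrier_mat n n" and "invertible_mat A"
  shows "inv_mat A \<in> carrier_mat n n" "A * inv_mat A = 1\<^sub>m n" "inv_mat A * A = 1\<^sub>m n"
proof -
  obtain B where B: "inverts_mat A B" "inverts_mat B A"
    using assms by (auto simp: invertible_mat_def)
  from B A have AB: "A * B = 1\<^sub>m n" and BA: "B * A = 1\<^sub>m (dim_row B)"
    by (auto simp: inverts_mat_def)
  have "dim_col B = n" using arg_cong[OF AB, of dim_col] by simp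
  moreover have "dim_row B = n" using arg_cong[OF BA, of dim_col] A by simp
  ultimately have "B \<in> carrier_mat n n" by auto
  with A AB BA have "A \<in> Units (ring_mat TYPE('a) n ())"
    by (auto simp: Units_def ring_mat_def)
  then obtain C where "mat_inverse A = Some C"
    using mat_inverse(1)[OF A, where b = "()"] by (cases "mat_inverse A") auto
  with mat_inverse(2)[OF A this]
  show "inv_mat A \<in> carrier_mat n n" "A * inv_mat A = 1\<^sub>m n" "inv_mat A * A = 1\<^sub>m n"
    by (auto simp: inv_mat_def)
qed

(* The block matrix is circulant as soon as b0 is real and a is hermitian symmetric. *)
lemma circulant_embedding_circulant:
  assumes "\<And>k. a (- k) = cnj (a k)" and "cnj b0 = b0" and "j < 2 * n" and "k < 2 * n"
  defines "d \<equiv> (int j - int k) mod (2 * int n)"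
  shows "circulant_embedding a n b0 $$ (j, k) =
    (if d < int n then a d else if d = int n then b0 else a (d - 2 * int n))"
proof -
  have d: "d = (if k \<le> j then int j - int k else int j - int k + 2 * int n)"
  proof (cases "k \<le> j")
    case True
    then show ?thesis using assms(3,4) by (simp add: d_def)
  next
    case False
    have "(int j - int k) mod (2 * int n) = (int j - int k + 2 * int n) mod (2 * int n)" by simp
    also have "\<dots> = int j - int k + 2 * int n"
      using False assms(3,4) by (intro mod_pos_pos_trivial) auto
    finally show ?thesis using False by (simp add: d_def)
  qed
  have sym: "cnj (a k) = a (- k)" for k using assms(1) by simp
  have adj: "mat_adjoint (corner_mat a n b0) $$ (i, l) = cnj (corner_mat a n b0 $$ (l, i))"
    if "i < n" "l < n" for i l
    using that by (simp add: mat_adjoint_def mat_of_rows_def corner_mat_def)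
  have dims: "mat_adjoint (corner_mat a n b0) \<in> carrier_mat n n"
    by (auto simp: mat_adjoint_def corner_mat_def mat_of_rows_def)
  show ?thesis
    using assms(2-4) dims
    unfolding d circulant_embedding_def
    apply (subst index_mat_four_block)
    apply (auto simp: toeplitz_mat_def adj)
    apply (auto simp: corner_mat_def sym of_nat_diff algebra_simps)
    done
qed

end

theory Submission
  imports Defs "HOL-Library.Periodic_Fun" "HOL-Number_Theory.Cong"
begin

text \<open>
  Averaging the quadratic form of the \<open>2n \<times> 2n\<close> Toeplitz section over the cyclic shifts of a vector
  gives, up to an error \<open>O(1/n)\<close>, the quadratic form of \<open>C\<^sub>2\<^sub>n\<close>. Hence \<open>C\<^sub>2\<^sub>n\<close> inherits the lower bound
  \<open>f\<^sub>m\<^sub>i\<^sub>n\<close> of the Toeplitz form asymptotically, and it keeps half of it after conjugation with a slowly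
  growing exponential weight (the Combes-Thomas argument). Now \<open>z\<close> is the first half of the solution
  \<open>(z, w)\<close> of \<open>C\<^sub>2\<^sub>n (z, w) = (y, 0)\<close>. Since \<open>y\<close> is concentrated at \<open>n/2\<close>, the weighted estimate makes
  \<open>w\<close> exponentially small, and so is \<open>x - z = A\<^sub>n\<^sup>-\<^sup>1 B\<^sub>n\<^sup>* w\<close>. For the finitely many remaining \<open>n\<close>,
  where \<open>C\<^sub>2\<^sub>n\<close> is merely invertible, any bound will do.

  This yields \<open>K e\<^sup>-\<^sup>\<delta>\<^sup>n\<close> with \<open>K\<close> depending on all the data. As \<open>\<gamma>\<^sub>1\<close> may be chosen after \<open>K\<close>, taking
  \<open>\<gamma>\<^sub>1 \<le> 1/(K + 1)\<close> makes \<open>c\<^sub>1 = 1/\<gamma>\<^sub>1\<close> sufficient.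
\<close>

section \<open>Quadratic forms, the Schur test and coercivity\<close>

text \<open>Kernels and vectors are plain functions of which only the values below \<open>N\<close>
  matter, so that cyclic shifts and exponential weights can be applied to the indices without
  dimension bookkeeping.\<close>

definition qform :: "nat \<Rightarrow> (nat \<Rightarrow> nat \<Rightarrow> complex) \<Rightarrow> (nat \<Rightarrow> complex) \<Rightarrow> complex" where
  "qform N K u = (\<Sum>j<N. \<Sum>k<N. K j k * u k * cnj (u j))"

definition sqnorm :: "nat \<Rightarrow> (nat \<Rightarrow> complex) \<Rightarrow> real" where
  "sqnorm N u = (\<Sum>k<N. (cmod (u k))\<^sup>2)"

lemma sqnorm_nonneg: "0 \<le> sqnorm N u"
  by (simp add: sqnorm_def sum_nonneg)

lemma qform_diff: "qform N K u - qform N L u = qform N (\<lambda>j k. K j k - L j k) u"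
  by (simp add: qform_def sum_subtractf[symmetric] left_diff_distrib)

lemma two_mult_le: "2 * (x * y) \<le> x\<^sup>2 + (y::real)\<^sup>2"
  using sum_squares_bound[of x y] by simp

text \<open>By \<open>two_mult_le\<close> each product of two entries of \<open>u\<close> is at most
  the mean of their squares. The form thus splits into a part governed by column sums and a part
  governed by row sums, each contributing half of \<open>R\<close>.\<close>

lemma schur_test:
  assumes "\<And>j k. j < N \<Longrightarrow> k < N \<Longrightarrow> cmod (P j k) \<le> h j k"
    and rows: "\<And>j. j < N \<Longrightarrow> (\<Sum>k<N. h j k) \<le> R"
    and cols: "\<And>k. k < N \<Longrightarrow> (\<Sum>j<N. h j k) \<le> R"
  shows "cmod (qform N P u) \<le> R * sqnorm N u"
proof -
  have "cmod (qform N P u) \<le> (\<Sum>j<N. \<Sum>k<N. cmod (P j k * u k * cnj (u j)))"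
    unfolding qform_def by (intro order.trans[OF norm_sum] sum_mono order.refl)
  also have "\<dots> \<le> (\<Sum>j<N. \<Sum>k<N. h j k * (((cmod (u k))\<^sup>2 + (cmod (u j))\<^sup>2) / 2))"
  proof (intro sum_mono)
    fix j k assume jk: "j \<in> {..<N}" "k \<in> {..<N}"
    have "cmod (P j k * u k * cnj (u j)) = cmod (P j k) * (cmod (u k) * cmod (u j))"
      by (simp add: norm_mult)
    also have "\<dots> \<le> h j k * (((cmod (u k))\<^sup>2 + (cmod (u j))\<^sup>2) / 2)"
      using jk assms(1)[of j k] two_mult_le[of "cmod (u k)" "cmod (u j)"]
      by (intro mult_mono) (auto intro: order.trans[OF norm_ge_zero])
    finally show "cmod (P j k * u k * cnj (u j)) \<le> h j k * (((cmod (u k))\<^sup>2 + (cmod (u j))\<^sup>2) / 2)" .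
  qed
  also have "\<dots> = (\<Sum>j<N. \<Sum>k<N. h j k * (cmod (u k))\<^sup>2) / 2 + (\<Sum>j<N. \<Sum>k<N. h j k * (cmod (u j))\<^sup>2) / 2"
    by (simp add: sum.distrib sum_divide_distrib algebra_simps add_divide_distrib)
  also have "(\<Sum>j<N. \<Sum>k<N. h j k * (cmod (u k))\<^sup>2) = (\<Sum>k<N. (\<Sum>j<N. h j k) * (cmod (u k))\<^sup>2)"
    by (subst sum.swap) (simp add: sum_distrib_right)
  also have "(\<Sum>k<N. (\<Sum>j<N. h j k) * (cmod (u k))\<^sup>2) \<le> (\<Sum>k<N. R * (cmod (u k))\<^sup>2)"
    using cols by (intro sum_mono mult_right_mono) auto
  also have "(\<Sum>j<N. \<Sum>k<N. h j k * (cmod (u j))\<^sup>2) = (\<Sum>j<N. (\<Sum>k<N. h j k) * (cmod (u j))\<^sup>2)"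
    by (simp add: sum_distrib_right)
  also have "(\<Sum>j<N. (\<Sum>k<N. h j k) * (cmod (u j))\<^sup>2) \<le> (\<Sum>j<N. R * (cmod (u j))\<^sup>2)"
    using rows by (intro sum_mono mult_right_mono) auto
  finally show ?thesis by (simp add: sqnorm_def sum_distrib_left)
qed

text \<open>An a priori estimate of Lax-Milgram type: the system is tested with its own solution,
  and Young's inequality with parameter \<open>m\<close> lets half of the coercive term absorb
  \<open>u\<close>. The factor \<open>N\<close> comes from bounding the right-hand side entrywise;
  \<open>\<rho> = 0\<close> gives uniqueness.\<close>

lemma coercive_solution_bound:
  assumes m: "0 < m" and coer: "m * sqnorm N u \<le> Re (qform N K u)"
    and rhs: "\<And>j. j < N \<Longrightarrow> cmod (\<Sum>k<N. K j k * u k) \<le> \<rho>"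
  shows "sqnorm N u \<le> real N * \<rho>\<^sup>2 / m\<^sup>2"
proof -
  define r where "r j = (\<Sum>k<N. K j k * u k)" for j
  have "qform N K u = (\<Sum>j<N. r j * cnj (u j))"
    by (simp add: qform_def r_def sum_distrib_right)
  then have "Re (qform N K u) \<le> cmod (\<Sum>j<N. r j * cnj (u j))"
    by (simp only: complex_Re_le_cmod)
  also have "\<dots> \<le> (\<Sum>j<N. cmod (r j) * cmod (u j))"
    by (intro order.trans[OF norm_sum]) (simp add: norm_mult)
  also have "\<dots> \<le> (\<Sum>j<N. \<rho>\<^sup>2 / (2 * m) + m / 2 * (cmod (u j))\<^sup>2)"
  proof (intro sum_mono)
    fix j assume j: "j \<in> {..<N}"
    have "cmod (r j) * cmod (u j) \<le> \<rho> * cmod (u j)"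
      using rhs j by (intro mult_right_mono) (auto simp: r_def)
    also have "2 * m * (\<rho> * cmod (u j)) \<le> \<rho>\<^sup>2 + (m * cmod (u j))\<^sup>2"
      using two_mult_le[of \<rho> "m * cmod (u j)"] by (simp add: algebra_simps)
    then have "\<rho> * cmod (u j) \<le> (\<rho>\<^sup>2 + (m * cmod (u j))\<^sup>2) / (2 * m)"
      using m by (simp add: field_simps)
    also have "\<dots> = \<rho>\<^sup>2 / (2 * m) + m / 2 * (cmod (u j))\<^sup>2"
      using m by (simp add: field_simps power2_eq_square)
    finally show "cmod (r j) * cmod (u j) \<le> \<rho>\<^sup>2 / (2 * m) + m / 2 * (cmod (u j))\<^sup>2" .
  qed
  also have "\<dots> = real N * \<rho>\<^sup>2 / (2 * m) + m / 2 * sqnorm N u"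
    by (simp add: sum.distrib sqnorm_def sum_distrib_left)
  finally have "m / 2 * sqnorm N u \<le> real N * \<rho>\<^sup>2 / (2 * m)"
    using coer by linarith
  then show ?thesis using m by (simp add: field_simps power2_eq_square)
qed

section \<open>Toeplitz forms and their lower bound\<close>

lemma toeplitz_coeff_integrable:
  assumes "continuous_on UNIV f"
  shows "(\<lambda>\<omega>. of_real (f \<omega>) * exp (2 * of_real pi * \<i> * of_real \<omega> * of_int k) :: complex)
    integrable_on {-1/2..1/2::real}"
  using continuous_on_subset[OF assms subset_UNIV]
  by (intro integrable_continuous_real continuous_intros)

lemma toeplitz_coeff_uminus:
  assumes "continuous_on UNIV f"
  shows "toeplitz_coeff f (- k) = cnj (toeplitz_coeff f k)"
  unfolding toeplitz_coeff_def
  by (subst integral_cnj) (simp add: exp_cnj)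

text \<open>The exponential with frequency \<open>j - k\<close> factors, so the double sum is
  \<open>f\<close> times the squared modulus of the trigonometric polynomial with coefficients
  \<open>v\<close>, integrated over one period.\<close>

lemma toeplitz_form_has_integral:
  fixes v :: "nat \<Rightarrow> complex"
  assumes f: "continuous_on UNIV f"
  shows "((\<lambda>\<omega>. f \<omega> * (cmod (\<Sum>l<N. v l * exp (- (2 * of_real pi * \<i> * of_real \<omega> * of_nat l))))\<^sup>2)
    has_integral Re (qform N (\<lambda>j k. toeplitz_coeff f (int j - int k)) v)) {-1/2..1/2}"
proof -
  define e where "e k \<omega> = exp (2 * of_real pi * \<i> * of_real \<omega> * of_int k)" for k :: int and \<omega> :: real
  define p where "p \<omega> = (\<Sum>l<N. v l * exp (- (2 * of_real pi * \<i> * of_real \<omega> * of_nat l)))" for \<omega> :: real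
  have "((\<lambda>\<omega>. \<Sum>j<N. \<Sum>k<N. of_real (f \<omega>) * e (int j - int k) \<omega> * v k * cnj (v j))
     has_integral qform N (\<lambda>j k. toeplitz_coeff f (int j - int k)) v) {-1/2..1/2}"
    unfolding qform_def toeplitz_coeff_def e_def
    by (intro has_integral_sum finite_lessThan has_integral_mult_left integrable_integral
        toeplitz_coeff_integrable f)
  also have "(\<lambda>\<omega>. \<Sum>j<N. \<Sum>k<N. of_real (f \<omega>) * e (int j - int k) \<omega> * v k * cnj (v j)) =
     (\<lambda>\<omega>. of_real (f \<omega> * (cmod (p \<omega>))\<^sup>2))"
  proof
    fix \<omega>
    have "of_real (f \<omega> * (cmod (p \<omega>))\<^sup>2) = of_real (f \<omega>) * (cnj (p \<omega>) * p \<omega>)"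
      by (simp only: of_real_mult complex_norm_square mult.commute of_real_power[symmetric])
    also have "cnj (p \<omega>) * p \<omega> = (\<Sum>j<N. \<Sum>k<N. e (int j - int k) \<omega> * v k * cnj (v j))"
      unfolding p_def cnj_sum sum_product e_def
      by (intro sum.cong refl) (simp add: exp_cnj exp_diff exp_minus algebra_simps divide_inverse)
    finally show "(\<Sum>j<N. \<Sum>k<N. of_real (f \<omega>) * e (int j - int k) \<omega> * v k * cnj (v j)) =
       of_real (f \<omega> * (cmod (p \<omega>))\<^sup>2)"
      by (simp add: sum_distrib_left mult.assoc)
  qed
  finally have "((\<lambda>\<omega>. Re (of_real (f \<omega> * (cmod (p \<omega>))\<^sup>2))) has_integral
      Re (qform N (\<lambda>j k. toeplitz_coeff f (int j - int k)) v)) {-1/2..1/2}"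
    by (rule has_integral_linear[OF _ bounded_linear_Re, unfolded o_def])
  then show ?thesis by (simp add: p_def)
qed

text \<open>Orthonormality of the exponentials. It identifies the form of the constant symbol 1 with
  the squared norm, which is Parseval's identity.\<close>

lemma toeplitz_coeff_one: "toeplitz_coeff (\<lambda>_. 1) k = (if k = 0 then 1 else 0)"
proof (cases "k = 0")
  case False
  define F where "F \<omega> = exp (2 * of_real pi * \<i> * of_real \<omega> * of_int k) / (2 * of_real pi * \<i> * of_int k)"
    for \<omega> :: real
  have "((\<lambda>\<omega>. exp (2 * of_real pi * \<i> * of_real \<omega> * of_int k)) has_integral (F (1/2) - F (-1/2))) {-1/2..1/2}"
  proof (rule fundamental_theorem_of_calculus)
    fix x :: real
    have "((\<lambda>z. exp (2 * of_real pi * \<i> * z * of_int k) / (2 * of_real pi * \<i> * of_int k))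
       has_field_derivative exp (2 * of_real pi * \<i> * of_real x * of_int k)) (at (of_real x))"
      using False by (auto intro!: derivative_eq_intros)
    from has_vector_derivative_real_field[OF this]
    show "(F has_vector_derivative exp (2 * of_real pi * \<i> * of_real x * of_int k)) (at x within {-1/2..1/2})"
      unfolding F_def .
  qed simp
  moreover have "F (1/2) = F (-1/2)"
  proof -
    have "exp (of_int k * of_real pi * \<i>) = exp (- (of_int k * of_real pi * \<i>))"
      by (simp add: exp_eq)
    then show ?thesis by (simp add: F_def mult_ac)
  qed
  ultimately show ?thesis using False
    by (simp add: toeplitz_coeff_def integral_unique)
qed (simp add: toeplitz_coeff_def)

text \<open>An infimum of reals is a lower bound only for sets bounded below. Periodicity places the
  range of \<open>f\<close> in the image of the compact interval from 0 to 1, which supplies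
  this.\<close>

lemma f_min_le:
  assumes "continuous_on UNIV f" and per: "\<And>\<omega>. f (\<omega> + 1) = f \<omega>"
  shows "f_min f \<le> f \<omega>"
proof -
  interpret periodic_fun_simple' f by standard (rule per)
  have "f x \<in> f ` {0..1}" for x
  proof -
    have "f x = f (frac x)" using plus_of_int[of "frac x" "\<lfloor>x\<rfloor>"] by (simp add: frac_def)
    moreover have "frac x \<in> {0..1}" using frac_lt_1[of x] by simp
    ultimately show ?thesis by blast
  qed
  then have "range f \<subseteq> f ` {0..1}" by blast
  moreover have "compact (f ` {0..1})"
    using assms(1) by (intro compact_continuous_image) (auto intro: continuous_on_subset)
  ultimately have "bdd_below (range f)"
    by (meson bdd_below_mono compact_imp_bounded bounded_imp_bdd_below)
  then show ?thesis by (simp add: f_min_def cInf_lower)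
qed

text \<open>The integral representations for \<open>f\<close> and for the constant symbol 1 contain
  the same polynomial, so \<open>f_min_le\<close> compares the integrands pointwise.\<close>

lemma toeplitz_coercive:
  assumes f: "continuous_on UNIV f" and per: "\<And>\<omega>. f (\<omega> + 1) = f \<omega>"
  shows "f_min f * sqnorm N v \<le> Re (qform N (\<lambda>j k. toeplitz_coeff f (int j - int k)) v)"
proof -
  have "Re (qform N (\<lambda>j k. toeplitz_coeff (\<lambda>_. 1) (int j - int k)) v) = sqnorm N v"
  proof -
    have "qform N (\<lambda>j k. toeplitz_coeff (\<lambda>_. 1) (int j - int k)) v =
       (\<Sum>j<N. \<Sum>k<N. if j = k then v k * cnj (v j) else 0)"
      unfolding qform_def toeplitz_coeff_one by (intro sum.cong refl) auto
    also have "\<dots> = of_real (sqnorm N v)"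
      by (simp add: sqnorm_def complex_norm_square del: of_real_power)
    finally show ?thesis by simp
  qed
  then have one: "((\<lambda>\<omega>. f_min f * (1 * (cmod (\<Sum>l<N. v l * exp (- (2 * of_real pi * \<i> * of_real \<omega> * of_nat l))))\<^sup>2))
      has_integral f_min f * sqnorm N v) {-1/2..1/2}"
    using toeplitz_form_has_integral[of "\<lambda>_. 1" v N] by (intro has_integral_mult_right) simp
  show ?thesis
    by (rule has_integral_le[OF one toeplitz_form_has_integral[OF f]])
      (auto intro!: mult_right_mono f_min_le[OF f per])
qed

section \<open>Averaging over cyclic shifts\<close>

lemma sum_cyclic_shift:
  fixes g :: "nat \<Rightarrow> 'a :: comm_monoid_add"
  assumes "0 < N"
  shows "(\<Sum>k<N. g ((k + s) mod N)) = (\<Sum>k<N. g k)"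
proof -
  have inj: "inj_on (\<lambda>k. (k + s) mod N) {..<N}"
    by (rule inj_onI) (metis cong_def cong_add_rcancel_nat lessThan_iff mod_less)
  have "(\<lambda>k. (k + s) mod N) ` {..<N} = {..<N}"
    using assms inj by (intro endo_inj_surj) auto
  with inj have "bij_betw (\<lambda>k. (k + s) mod N) {..<N} {..<N}" by (simp add: bij_betw_def)
  from sum.reindex_bij_betw[OF this] show ?thesis by simp
qed

text \<open>For circulant \<open>K\<close> the form is invariant under cyclic shifts, so only the entrywise distance of \<open>K\<close>
  and \<open>T\<close>, divided by \<open>N\<close>, is lost when the form of \<open>T\<close> is averaged over all shifts.\<close>

lemma circulant_coercive:
  assumes N: "0 < N"
    and circ: "\<And>j k s. j < N \<Longrightarrow> k < N \<Longrightarrow> K ((j + s) mod N) ((k + s) mod N) = K j k"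
    and coer: "\<And>v. m * sqnorm N v \<le> Re (qform N T v)"
    and D: "(\<Sum>j<N. \<Sum>k<N. cmod (K j k - T j k)) \<le> D"
  shows "(m - D / real N) * sqnorm N u \<le> Re (qform N K u)"
proof -
  define v where "v s k = u ((k + s) mod N)" for s k
  have sq: "sqnorm N (v s) = sqnorm N u" for s
    using sum_cyclic_shift[OF N, of "\<lambda>k. (cmod (u k))\<^sup>2" s] by (simp add: sqnorm_def v_def)
  have K: "qform N K (v s) = qform N K u" for s
  proof -
    have "qform N K (v s) = (\<Sum>j<N. \<Sum>k<N. K ((j + s) mod N) ((k + s) mod N)
        * u ((k + s) mod N) * cnj (u ((j + s) mod N)))"
      unfolding qform_def v_def by (intro sum.cong refl) (simp add: circ)
    also have "\<dots> = (\<Sum>j<N. \<Sum>k<N. K ((j + s) mod N) k * u k * cnj (u ((j + s) mod N)))"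
      by (intro sum.cong refl sum_cyclic_shift[OF N])
    also have "\<dots> = qform N K u"
      unfolding qform_def
      by (rule sum_cyclic_shift[OF N, of "\<lambda>j. \<Sum>k<N. K j k * u k * cnj (u j)" s])
    finally show ?thesis .
  qed
  have shift: "(\<Sum>s<N. (cmod (v s k))\<^sup>2) = sqnorm N u" for k
    using sum_cyclic_shift[OF N, of "\<lambda>k. (cmod (u k))\<^sup>2" k] by (simp add: sqnorm_def v_def add.commute)
  \<comment> \<open>This is where the factor \<open>1/N\<close> is gained: estimating each of the
    \<open>N\<close> shifts separately would give \<open>N * sqnorm N u\<close>, whereas an entry,
    followed through all shifts, runs over \<open>u\<close> just once.\<close>
  have corr: "cmod (\<Sum>s<N. v s k * cnj (v s j)) \<le> sqnorm N u" for j k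
  proof -
    have "cmod (\<Sum>s<N. v s k * cnj (v s j)) \<le> (\<Sum>s<N. ((cmod (v s k))\<^sup>2 + (cmod (v s j))\<^sup>2) / 2)"
    proof (intro order.trans[OF norm_sum] sum_mono)
      show "cmod (v s k * cnj (v s j)) \<le> ((cmod (v s k))\<^sup>2 + (cmod (v s j))\<^sup>2) / 2" for s
        using two_mult_le[of "cmod (v s k)" "cmod (v s j)"] by (simp add: norm_mult)
    qed
    also have "\<dots> = sqnorm N u"
      by (simp add: sum_divide_distrib[symmetric] sum.distrib shift)
    finally show ?thesis .
  qed
  have "cmod (\<Sum>s<N. qform N K (v s) - qform N T (v s)) =
      cmod (\<Sum>j<N. \<Sum>k<N. (K j k - T j k) * (\<Sum>s<N. v s k * cnj (v s j)))"
  proof (rule arg_cong[where f = cmod])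
    have "(\<Sum>s<N. qform N K (v s) - qform N T (v s)) =
      (\<Sum>j<N. \<Sum>s<N. \<Sum>k<N. (K j k - T j k) * v s k * cnj (v s j))"
      unfolding qform_diff unfolding qform_def by (rule sum.swap)
    also have "\<dots> = (\<Sum>j<N. \<Sum>k<N. \<Sum>s<N. (K j k - T j k) * v s k * cnj (v s j))"
      by (intro sum.cong refl sum.swap)
    finally show "(\<Sum>s<N. qform N K (v s) - qform N T (v s)) =
      (\<Sum>j<N. \<Sum>k<N. (K j k - T j k) * (\<Sum>s<N. v s k * cnj (v s j)))"
      by (simp add: sum_distrib_left mult.assoc)
  qed
  also have "\<dots> \<le> (\<Sum>j<N. \<Sum>k<N. cmod (K j k - T j k) * sqnorm N u)"
    by (intro order.trans[OF norm_sum] sum_mono) (simp add: norm_mult mult_left_mono corr)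
  also have "\<dots> = (\<Sum>j<N. \<Sum>k<N. cmod (K j k - T j k)) * sqnorm N u"
    by (simp add: sum_distrib_right)
  also have "\<dots> \<le> D * sqnorm N u"
    by (rule mult_right_mono[OF D sqnorm_nonneg])
  finally have diff: "cmod (\<Sum>s<N. qform N K (v s) - qform N T (v s)) \<le> D * sqnorm N u" .
  have "real N * (m * sqnorm N u) = (\<Sum>s<N. m * sqnorm N (v s))"
    by (simp add: sq)
  also have "\<dots> \<le> (\<Sum>s<N. Re (qform N T (v s)))"
    by (intro sum_mono coer)
  also have "\<dots> = real N * Re (qform N K u) - Re (\<Sum>s<N. qform N K (v s) - qform N T (v s))"
    by (simp add: sum_subtractf K)
  also have "\<dots> \<le> real N * Re (qform N K u) + D * sqnorm N u"
    using diff abs_Re_le_cmod[of "\<Sum>s<N. qform N K (v s) - qform N T (v s)"] by linarith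
  finally show ?thesis using N by (simp add: field_simps)
qed


section \<open>Circular distance and the entries of the circulant embedding\<close>

text \<open>With truncated subtraction, \<open>(j - k) + (k - j)\<close> is the distance of \<open>j\<close> and \<open>k\<close>.\<close>

definition circ_dist :: "nat \<Rightarrow> nat \<Rightarrow> nat \<Rightarrow> nat" where
  "circ_dist N j k = min ((j - k) + (k - j)) (N - ((j - k) + (k - j)))"

lemma circ_dist_commute: "circ_dist N j k = circ_dist N k j"
  by (simp add: circ_dist_def add.commute)

lemma sum_inj_le_suminf:
  fixes h :: "nat \<Rightarrow> real"
  assumes "summable h" "\<And>m. 0 \<le> h m" "finite I" "inj_on \<phi> I"
  shows "(\<Sum>k\<in>I. h (\<phi> k)) \<le> suminf h"
  using assms sum_le_suminf[of h "\<phi> ` I"] by (simp add: sum.reindex)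

text \<open>Keeps row sums bounded independently of \<open>N\<close>. On each side of
  \<open>j\<close> the value of \<open>h\<close> at the minimum is at most the sum of its values at
  both arguments; this gives four sums, each along an injective index map.\<close>

lemma sum_circ_dist_le:
  fixes h :: "nat \<Rightarrow> real"
  assumes h: "summable h" "\<And>m. 0 \<le> h m" and j: "j < N"
  shows "(\<Sum>k<N. h (circ_dist N j k)) \<le> 4 * suminf h"
proof -
  have min_le: "h (min p q) \<le> h p + h q" for p q
    using h(2)[of p] h(2)[of q] by (simp add: min_def)
  have "(\<Sum>k<N. h (circ_dist N j k)) =
      (\<Sum>k\<in>{..j}. h (circ_dist N j k)) + (\<Sum>k\<in>{j<..<N}. h (circ_dist N j k))"
    using j by (subst sum.union_disjoint[symmetric]) (auto intro!: sum.cong)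
  also have "\<dots> \<le> (\<Sum>k\<in>{..j}. h (j - k) + h (N - (j - k))) + (\<Sum>k\<in>{j<..<N}. h (k - j) + h (N - (k - j)))"
    using min_le by (intro add_mono sum_mono) (auto simp: circ_dist_def)
  also have "\<dots> \<le> (suminf h + suminf h) + (suminf h + suminf h)"
    unfolding sum.distrib using j
    by (intro add_mono sum_inj_le_suminf h) (auto simp: inj_on_def)
  finally show ?thesis by simp
qed

text \<open>In the lower right block the offset \<open>n\<close> cancels from \<open>j - k\<close>,
  so both diagonal blocks read the same formula.\<close>

lemma circulant_embedding_index:
  assumes "j < 2 * n" "k < 2 * n"
  shows "circulant_embedding a n b0 $$ (j, k) =
    (if j < n then if k < n then a (int j - int k) else cnj (corner_mat a n b0 $$ (k - n, j))
     else if k < n then corner_mat a n b0 $$ (j - n, k) else a (int j - int k))"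
proof -
  have "mat_adjoint (corner_mat a n b0) $$ (i, l) = cnj (corner_mat a n b0 $$ (l, i))"
    if "i < n" "l < n" for i l
    using that by (simp add: mat_adjoint_def mat_of_rows_def corner_mat_def)
  moreover have "mat_adjoint (corner_mat a n b0) \<in> carrier_mat n n"
    by (auto simp: mat_adjoint_def corner_mat_def mat_of_rows_def)
  ultimately show ?thesis
    using assms unfolding circulant_embedding_def
    by (subst index_mat_four_block) (auto simp: toeplitz_mat_def of_nat_diff)
qed

lemma circulant_embedding_carrier: "circulant_embedding a n b0 \<in> carrier_mat (2 * n) (2 * n)"
  by (auto simp: circulant_embedding_def toeplitz_mat_def mult_2)

text \<open>In every block the coefficient at \<open>(j, k)\<close> has an index of absolute value
  exactly \<open>circ_dist (2 * n) j k\<close>; the entries made from \<open>b0\<close> sit at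
  distance \<open>n\<close>.\<close>

lemma circulant_embedding_bound:
  assumes decay: "\<And>k :: int. cmod (a k) \<le> c * exp (- \<gamma> * \<bar>real_of_int k\<bar>)" and c: "0 \<le> c"
    and b0: "b0 \<in> {a (int n), 0}" and jk: "j < 2 * n" "k < 2 * n"
  shows "cmod (circulant_embedding a n b0 $$ (j, k)) \<le> c * exp (- \<gamma> * real (circ_dist (2 * n) j k))"
proof -
  have key: "cmod (a i) \<le> c * exp (- (\<gamma> * real d))" if "\<bar>i\<bar> = int d" for i d
  proof -
    have "\<bar>real_of_int i\<bar> = real d" using that by (metis of_int_abs of_int_of_nat_eq)
    then show ?thesis using decay[of i] by simp
  qed
  have b: "cmod b0 \<le> c * exp (- (\<gamma> * real n))"
    using b0 key[of "int n" n] c by auto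
  consider "j < n" "k < n" | "n \<le> j" "n \<le> k" | "j < n" "n \<le> k" | "n \<le> j" "k < n" by linarith
  then show ?thesis
  proof cases
    case 1
    then have "\<bar>int j - int k\<bar> = int (circ_dist (2 * n) j k)" using jk by (auto simp: circ_dist_def)
    from key[OF this] 1 jk show ?thesis by (simp add: circulant_embedding_index)
  next
    case 2
    then have "\<bar>int j - int k\<bar> = int (circ_dist (2 * n) j k)" using jk by (auto simp: circ_dist_def)
    from key[OF this] 2 jk show ?thesis by (simp add: circulant_embedding_index)
  next
    case 3
    define i where "i = k - n"
    have k: "k = n + i" "i < n" using 3 jk by (auto simp: i_def)
    consider "i = j" | "i < j" | "j < i" by linarith
    then show ?thesis
    proof cases
      case 1
      then show ?thesis using jk 3 k b
        by (simp add: circulant_embedding_index circ_dist_def corner_mat_def)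
    next
      case 2
      then have "\<bar>int n - (int j - int i)\<bar> = int (circ_dist (2 * n) j k)" using jk \<open>j < n\<close> k by (auto simp: circ_dist_def)
      from key[OF this] 2 jk \<open>j < n\<close> k show ?thesis
        by (simp add: circulant_embedding_index corner_mat_def)
    next
      case 3
      then have "\<bar>int n - (int i - int j)\<bar> = int (circ_dist (2 * n) j k)" using jk \<open>j < n\<close> k by (auto simp: circ_dist_def)
      from key[OF this] 3 jk \<open>j < n\<close> k show ?thesis
        by (simp add: circulant_embedding_index corner_mat_def)
    qed
  next
    case 4
    define i where "i = j - n"
    have j: "j = n + i" "i < n" using 4 jk by (auto simp: i_def)
    consider "i = k" | "i < k" | "k < i" by linarith
    then show ?thesis
    proof cases
      case 1
      then show ?thesis using jk 4 j b
        by (simp add: circulant_embedding_index circ_dist_def corner_mat_def)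
    next
      case 2
      then have "\<bar>int n - (int k - int i)\<bar> = int (circ_dist (2 * n) j k)" using jk \<open>k < n\<close> j by (auto simp: circ_dist_def)
      from key[OF this] 2 jk \<open>k < n\<close> j show ?thesis
        by (simp add: circulant_embedding_index corner_mat_def)
    next
      case 3
      then have "\<bar>int n - (int i - int k)\<bar> = int (circ_dist (2 * n) j k)" using jk \<open>k < n\<close> j by (auto simp: circ_dist_def)
      from key[OF this] 3 jk \<open>k < n\<close> j show ?thesis
        by (simp add: circulant_embedding_index corner_mat_def)
    qed
  qed
qed

text \<open>For non-real \<open>b0\<close> the entries \<open>b0\<close> and \<open>cnj b0\<close>
  at distance \<open>n\<close> prevent the matrix from being circulant. Passing to
  \<open>b0 = 0\<close> restores the shift invariance and changes at most one entry per row, by an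
  exponentially small amount when \<open>b0\<close> is \<open>a n\<close> or 0.\<close>

lemma circulant_embedding_corner_diff:
  assumes "j < 2 * n" "k < 2 * n"
  shows "cmod (circulant_embedding a n b0 $$ (j, k) - circulant_embedding a n 0 $$ (j, k)) \<le> cmod b0"
  using assms by (auto simp: circulant_embedding_index corner_mat_def)

text \<open>The kernels can differ only if \<open>j\<close> and \<open>k\<close> are at least
  \<open>n\<close> apart. Both entries are then of order \<open>exp (- \<gamma> * d)\<close>, where
  \<open>d\<close> is \<open>2 * n\<close> minus their distance. As \<open>d\<close> adds up the
  distances of the two indices to opposite ends, the bound is a product, and its double sum stays
  bounded in \<open>n\<close>.\<close>

lemma circulant_embedding_toeplitz_diff:
  assumes decay: "\<And>k :: int. cmod (a k) \<le> c * exp (- \<gamma> * \<bar>real_of_int k\<bar>)" and c: "0 \<le> c"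
    and \<gamma>: "0 < \<gamma>" and sym: "\<And>k. a (- k) = cnj (a k)" and jk: "j < 2 * n" "k < 2 * n"
  shows "cmod (circulant_embedding a n 0 $$ (j, k) - a (int j - int k)) \<le>
    2 * c * (exp (- \<gamma> * real (2 * n - j)) * exp (- \<gamma> * real k) +
             exp (- \<gamma> * real (2 * n - k)) * exp (- \<gamma> * real j))"
proof (cases "j < n \<and> k < n \<or> n \<le> j \<and> n \<le> k \<or> (j - k) + (k - j) < n")
  case True
  then have "circulant_embedding a n 0 $$ (j, k) = a (int j - int k)"
    using jk by (auto simp: circulant_embedding_index corner_mat_def sym[symmetric])
  then show ?thesis using c by simp
next
  case False
  define d where "d = circ_dist (2 * n) j k"
  have d: "2 * n - ((j - k) + (k - j)) = d" using False jk by (auto simp: d_def circ_dist_def min_def)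
  have "cmod (circulant_embedding a n 0 $$ (j, k)) \<le> c * exp (- \<gamma> * real d)"
    unfolding d_def by (rule circulant_embedding_bound[OF decay c _ jk]) simp
  moreover have "cmod (a (int j - int k)) \<le> c * exp (- \<gamma> * real d)"
  proof -
    have "real d \<le> \<bar>real_of_int (int j - int k)\<bar>" using False jk unfolding d[symmetric] by linarith
    then have "c * exp (- \<gamma> * \<bar>real_of_int (int j - int k)\<bar>) \<le> c * exp (- \<gamma> * real d)"
      using \<gamma> c by (intro mult_left_mono) auto
    then show ?thesis using decay[of "int j - int k"] by linarith
  qed
  ultimately have "cmod (circulant_embedding a n 0 $$ (j, k) - a (int j - int k)) \<le> 2 * c * exp (- \<gamma> * real d)"
    using norm_triangle_ineq4[of "circulant_embedding a n 0 $$ (j, k)" "a (int j - int k)"] by linarith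
  also have "exp (- \<gamma> * real d) \<le> exp (- \<gamma> * real (2 * n - j)) * exp (- \<gamma> * real k) +
             exp (- \<gamma> * real (2 * n - k)) * exp (- \<gamma> * real j)"
  proof (cases "k \<le> j")
    case True
    then have "real d = real (2 * n - j) + real k" using jk unfolding d[symmetric] by simp
    then show ?thesis by (simp add: exp_add[symmetric] algebra_simps)
  next
    case False
    then have "real d = real (2 * n - k) + real j" using jk unfolding d[symmetric] by simp
    then show ?thesis by (simp add: exp_add[symmetric] algebra_simps)
  qed
  finally show ?thesis using c by (simp add: mult_left_mono)
qed

lemma circulant_embedding_shift:
  assumes sym: "\<And>k. a (- k) = cnj (a k)" and "j < 2 * n" "k < 2 * n"
  shows "circulant_embedding a n 0 $$ ((j + s) mod (2 * n), (k + s) mod (2 * n)) =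
    circulant_embedding a n 0 $$ (j, k)"
proof -
  have "(int ((j + s) mod (2 * n)) - int ((k + s) mod (2 * n))) mod (2 * int n) =
      (int j - int k) mod (2 * int n)"
    by (simp add: zmod_int mod_simps)
  then show ?thesis
    using assms by (simp add: circulant_embedding_circulant)
qed

section \<open>The exponential weight\<close>

lemma abs_exp_minus_one_le: "\<bar>exp t - 1\<bar> \<le> \<bar>t\<bar> * exp \<bar>t\<bar>" for t :: real
proof (cases "0 \<le> t")
  case True
  have "1 - t \<le> exp (- t)" using exp_ge_add_one_self[of "- t"] by simp
  then have "(1 - t) * exp t \<le> exp (- t) * exp t" by (intro mult_right_mono) auto
  then show ?thesis using True by (simp add: algebra_simps exp_minus)
next
  case False
  have "1 - exp t \<le> - t" using exp_ge_add_one_self[of t] by linarith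
  also have "- t \<le> - t * exp (- t)" using False by (simp add: mult_le_cancel_left1)
  finally show ?thesis using False by simp
qed

lemma summable_exp_minus: "0 < \<gamma> \<Longrightarrow> summable (\<lambda>m. exp (- \<gamma> * real m))"
proof -
  assume "0 < \<gamma>"
  then have "summable (\<lambda>m. exp (- \<gamma>) ^ m)" by (intro summable_geometric) simp
  then show ?thesis by (simp add: exp_of_nat_mult[symmetric] mult.commute)
qed

text \<open>The cap at \<open>n/2\<close> makes the weight constant on the second half of \<open>{0..<2n}\<close> and hence Lipschitz for
  the circular distance.\<close>

definition weight :: "nat \<Rightarrow> nat \<Rightarrow> real" where
  "weight n j = min \<bar>real n / 2 - real j\<bar> (real n / 2)"

lemma weight_lipschitz:
  assumes "j < 2 * n" "k < 2 * n"
  shows "\<bar>weight n j - weight n k\<bar> \<le> real (circ_dist (2 * n) j k)"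
proof -
  have *: "\<bar>weight n j - weight n k\<bar> \<le> real (circ_dist (2 * n) j k)"
    if "k \<le> j" "j < 2 * n" for j k
  proof -
    have "real (circ_dist (2 * n) j k) = min (real j - real k) (2 * real n - (real j - real k))"
      using that by (simp add: circ_dist_def of_nat_diff of_nat_min)
    moreover have "real k \<le> real j" "real j \<le> 2 * real n" "0 \<le> real k" using that by simp_all
    ultimately show ?thesis unfolding weight_def min_def abs_if by (auto split: if_splits)
  qed
  show ?thesis
    using *[of k j] *[of j k] assms circ_dist_commute[of "2 * n" j k]
    by (cases "k \<le> j") (auto simp: abs_minus_commute)
qed

section \<open>Coercivity of the weighted embedding and decay of its solutions\<close>

locale decaying_symbol =
  fixes f :: "real \<Rightarrow> real" and \<gamma> c :: real
  assumes cont: "continuous_on UNIV f" and per: "\<And>\<omega>. f (\<omega> + 1) = f \<omega>"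
    and f_min_pos: "0 < f_min f" and gamma_pos: "0 < \<gamma>"
    and decay: "\<And>k :: int. cmod (toeplitz_coeff f k) \<le> c * exp (- \<gamma> * \<bar>real_of_int k\<bar>)"
begin

abbreviation coeff :: "int \<Rightarrow> complex" where
  "coeff \<equiv> toeplitz_coeff f"

abbreviation embed :: "nat \<Rightarrow> complex \<Rightarrow> nat \<Rightarrow> nat \<Rightarrow> complex" where
  "embed n b j k \<equiv> circulant_embedding coeff n b $$ (j, k)"

lemma c_nonneg: "0 \<le> c"
  using order.trans[OF norm_ge_zero decay[of 0]] by simp

text \<open>Shift averaging against the Toeplitz section of size \<open>2 * n\<close>. The entry
  differences sum to at most \<open>4 * c * G\<^sup>2\<close> with the geometric sum
  \<open>G\<close>, and division by \<open>2 * n\<close> leaves the stated loss.\<close>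

lemma embed_zero_coercive:
  assumes n: "1 \<le> n"
  shows "(f_min f - 2 * c * (\<Sum>m. exp (- \<gamma> * real m))\<^sup>2 / real n) * sqnorm (2 * n) u
    \<le> Re (qform (2 * n) (embed n 0) u)"
proof -
  define G where "G = (\<Sum>m. exp (- \<gamma> * real m))"
  have G: "(\<Sum>k<2 * n. exp (- \<gamma> * real k)) \<le> G" "(\<Sum>k<2 * n. exp (- \<gamma> * real (2 * n - k))) \<le> G"
    unfolding G_def
    by (rule sum_inj_le_suminf[OF summable_exp_minus[OF gamma_pos]]; force simp: inj_on_def)+
  have "(\<Sum>j<2 * n. \<Sum>k<2 * n. cmod (embed n 0 j k - coeff (int j - int k))) \<le>
      (\<Sum>j<2 * n. \<Sum>k<2 * n. 2 * c * (exp (- \<gamma> * real (2 * n - j)) * exp (- \<gamma> * real k) +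
             exp (- \<gamma> * real (2 * n - k)) * exp (- \<gamma> * real j)))"
    by (intro sum_mono circulant_embedding_toeplitz_diff decay c_nonneg gamma_pos
        toeplitz_coeff_uminus cont) auto
  also have "\<dots> = 2 * c * ((\<Sum>j<2 * n. \<Sum>k<2 * n. exp (- \<gamma> * real (2 * n - j)) * exp (- \<gamma> * real k)) +
      (\<Sum>j<2 * n. \<Sum>k<2 * n. exp (- \<gamma> * real (2 * n - k)) * exp (- \<gamma> * real j)))"
    by (simp only: sum_distrib_left[symmetric] sum.distrib)
  also have "(\<Sum>j<2 * n. \<Sum>k<2 * n. exp (- \<gamma> * real (2 * n - k)) * exp (- \<gamma> * real j)) =
      (\<Sum>j<2 * n. \<Sum>k<2 * n. exp (- \<gamma> * real (2 * n - j)) * exp (- \<gamma> * real k))"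
    by (rule sum.swap)
  also have "(\<Sum>j<2 * n. \<Sum>k<2 * n. exp (- \<gamma> * real (2 * n - j)) * exp (- \<gamma> * real k)) =
      (\<Sum>k<2 * n. exp (- \<gamma> * real (2 * n - k))) * (\<Sum>k<2 * n. exp (- \<gamma> * real k))"
    by (rule sum_product[symmetric])
  also have "2 * c * (\<dots> + \<dots>) \<le> 2 * c * (G * G + G * G)"
    using G c_nonneg order.trans[OF sum_nonneg G(1)]
    by (intro mult_left_mono add_mono mult_mono) (auto intro!: sum_nonneg)
  finally have D: "(\<Sum>j<2 * n. \<Sum>k<2 * n. cmod (embed n 0 j k - coeff (int j - int k))) \<le> 4 * c * G\<^sup>2"
    by (simp add: power2_eq_square)
  have "(f_min f - 4 * c * G\<^sup>2 / real (2 * n)) * sqnorm (2 * n) u \<le> Re (qform (2 * n) (embed n 0) u)"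
    using n by (intro circulant_coercive[OF _ _ toeplitz_coercive[OF cont per] D]
      circulant_embedding_shift toeplitz_coeff_uminus cont) auto
  then show ?thesis by (simp add: G_def mult.assoc)
qed

text \<open>The first term pays for replacing \<open>b\<close> by 0, the second for the weight. Of
  the decay rate \<gamma>, the weight uses up at most \<gamma>/2 and the Lipschitz factor
  \<open>d\<close> another \<gamma>/4, so \<gamma>/4 survives; the prefactor \<delta> makes the
  second term small.\<close>

lemma weighted_entry_bound:
  assumes b: "b \<in> {coeff (int n), 0}" and jk: "j < 2 * n" "k < 2 * n"
    and \<delta>: "0 < \<delta>" "\<delta> \<le> \<gamma> / 2"
  shows "cmod (embed n b j k * of_real (exp (\<delta> * (weight n j - weight n k))) - embed n 0 j k)
    \<le> c * exp (- \<gamma> * real n) + 4 * c * \<delta> / \<gamma> * exp (- (\<gamma> / 4) * real (circ_dist (2 * n) j k))"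
proof -
  define d where "d = real (circ_dist (2 * n) j k)"
  define t where "t = \<delta> * (weight n j - weight n k)"
  have d0: "0 \<le> d" by (simp add: d_def)
  have t: "\<bar>t\<bar> \<le> \<delta> * d"
    using weight_lipschitz[OF jk] \<delta> by (simp add: t_def d_def abs_mult)
  have "\<bar>exp t - 1\<bar> \<le> \<bar>t\<bar> * exp \<bar>t\<bar>" by (rule abs_exp_minus_one_le)
  also have "\<dots> \<le> \<delta> * d * exp (\<delta> * d)"
    using t \<delta> d0 by (intro mult_mono) auto
  also have "\<dots> \<le> \<delta> * (4 / \<gamma> * exp (\<gamma> / 4 * d)) * exp (\<gamma> / 2 * d)"
  proof (intro mult_mono)
    have "\<gamma> / 4 * d \<le> exp (\<gamma> / 4 * d)" using exp_ge_add_one_self[of "\<gamma> / 4 * d"] by linarith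
    then show "d \<le> 4 / \<gamma> * exp (\<gamma> / 4 * d)" using gamma_pos by (simp add: field_simps)
    have "\<delta> * d \<le> \<gamma> / 2 * d" using \<delta> d0 by (intro mult_right_mono) auto
    then show "exp (\<delta> * d) \<le> exp (\<gamma> / 2 * d)" by simp
  qed (use \<delta> d0 gamma_pos in auto)
  finally have t1: "\<bar>exp t - 1\<bar> \<le> 4 * \<delta> / \<gamma> * (exp (\<gamma> / 4 * d) * exp (\<gamma> / 2 * d))" by (simp add: mult_ac)
  have "embed n b j k * of_real (exp t) - embed n 0 j k =
      (embed n b j k - embed n 0 j k) + embed n b j k * of_real (exp t - 1)"
    by (simp add: algebra_simps)
  also have "cmod \<dots> \<le> cmod (embed n b j k - embed n 0 j k) + cmod (embed n b j k) * \<bar>exp t - 1\<bar>"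
    by (intro order.trans[OF norm_triangle_ineq]) (simp add: norm_mult del: of_real_diff)
  also have "cmod (embed n b j k - embed n 0 j k) \<le> cmod b"
    by (rule circulant_embedding_corner_diff[OF jk])
  also have "cmod b \<le> c * exp (- \<gamma> * real n)"
    using b decay[of "int n"] c_nonneg by auto
  also have "cmod (embed n b j k) * \<bar>exp t - 1\<bar> \<le>
      (c * exp (- \<gamma> * d)) * (4 * \<delta> / \<gamma> * (exp (\<gamma> / 4 * d) * exp (\<gamma> / 2 * d)))"
    using circulant_embedding_bound[OF decay c_nonneg b jk] t1 c_nonneg
    by (intro mult_mono) (auto simp: d_def)
  also have "\<dots> = 4 * c * \<delta> / \<gamma> * exp (- \<gamma> * d + (\<gamma> / 4 * d + \<gamma> / 2 * d))"
    unfolding exp_add by (simp add: mult_ac)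
  also have "- \<gamma> * d + (\<gamma> / 4 * d + \<gamma> / 2 * d) = - (\<gamma> / 4) * d" by simp
  finally show ?thesis by (simp add: t_def d_def)
qed

text \<open>The kernel is that of the embedding conjugated by the diagonal matrix with entries
  \<open>exp (\<delta> * weight n j)\<close>.\<close>

definition coercive_weight :: "real \<Rightarrow> nat \<Rightarrow> complex \<Rightarrow> bool" where
  "coercive_weight \<delta> n b \<longleftrightarrow> (\<forall>u. f_min f / 2 * sqnorm (2 * n) u \<le>
      Re (qform (2 * n) (\<lambda>j k. embed n b j k * of_real (exp (\<delta> * (weight n j - weight n k)))) u))"

lemma coercive_weight_exists:
  "\<exists>\<delta> n0. 0 < \<delta> \<and> \<delta> \<le> \<gamma> \<and> (\<forall>n b. n0 \<le> n \<longrightarrow> b \<in> {coeff (int n), 0} \<longrightarrow> coercive_weight \<delta> n b)"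
proof -
  define G where "G = (\<Sum>m. exp (- \<gamma> * real m))"
  define G4 where "G4 = (\<Sum>m. exp (- (\<gamma> / 4) * real m))"
  have summable: "summable (\<lambda>m. exp (- (\<gamma> / 4) * real m))"
    using gamma_pos by (intro summable_exp_minus) simp
  have G4: "0 \<le> G4" unfolding G4_def by (intro suminf_nonneg summable) auto
  \<comment> \<open>\<open>\<delta> * B\<close> is the row sum bound of the weight error:
    \<open>4 * c * \<delta> / \<gamma>\<close> times the bound \<open>4 * G4\<close> from
    \<open>sum_circ_dist_le\<close>.\<close>
  define B where "B = 16 * c * G4 / \<gamma>"
  have B: "0 \<le> B" using G4 c_nonneg gamma_pos by (simp add: B_def)
  define \<delta> where "\<delta> = min (\<gamma> / 2) (f_min f / (8 * (B + 1)))"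
  have \<delta>: "0 < \<delta>" using gamma_pos f_min_pos B by (auto simp: \<delta>_def)
  moreover have "\<delta> \<le> \<gamma> / 2" unfolding \<delta>_def by (rule min.cobounded1)
  ultimately have \<delta>: "0 < \<delta>" "\<delta> \<le> \<gamma> / 2" by auto
  have "\<delta> * B \<le> f_min f / (8 * (B + 1)) * (B + 1)"
    using B f_min_pos \<delta> by (intro mult_mono) (auto simp: \<delta>_def)
  also have "\<dots> = f_min f / 8" using B by (simp add: divide_simps)
  finally have \<delta>B: "\<delta> * B \<le> f_min f / 8" .
  \<comment> \<open>The corner error \<open>c * exp (- \<gamma> * real n)\<close> occurs
    \<open>2 * n\<close> times in the row sum of \<open>h\<close>.\<close>
  have "(\<lambda>n. 2 * c * (real n / exp \<gamma> ^ n)) \<longlonglongrightarrow> 2 * c * 0"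
    using gamma_pos by (intro tendsto_intros lim_n_over_pown) simp
  then have "eventually (\<lambda>n. 2 * c * (real n / exp \<gamma> ^ n) < f_min f / 8) sequentially"
    using f_min_pos by (intro order_tendstoD(2)[where a = "f_min f / 8"]) auto
  moreover have "(\<lambda>n. 2 * c * G\<^sup>2 / real n) \<longlonglongrightarrow> 0"
    by (rule lim_const_over_n)
  then have "eventually (\<lambda>n. 2 * c * G\<^sup>2 / real n < f_min f / 8) sequentially"
    using f_min_pos by (intro order_tendstoD(2)[where a = "f_min f / 8"]) auto
  ultimately have "eventually (\<lambda>n. 1 \<le> n \<and> 2 * c * (real n / exp \<gamma> ^ n) < f_min f / 8 \<and>
      2 * c * G\<^sup>2 / real n < f_min f / 8) sequentially"
    using eventually_ge_at_top[of "1::nat"] by eventually_elim simp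
  then obtain n1 where n1: "\<And>n. n1 \<le> n \<Longrightarrow> 1 \<le> n \<and> 2 * c * (real n / exp \<gamma> ^ n) < f_min f / 8 \<and>
      2 * c * G\<^sup>2 / real n < f_min f / 8"
    by (auto simp: eventually_sequentially)
  show ?thesis
  proof (intro exI[of _ \<delta>] exI[of _ n1] conjI allI impI)
    fix n b assume n: "n1 \<le> n" and b: "b \<in> {coeff (int n), 0}"
    show "coercive_weight \<delta> n b"
      unfolding coercive_weight_def
    proof
      fix u
      let ?W = "\<lambda>j k. embed n b j k * of_real (exp (\<delta> * (weight n j - weight n k)))"
      define h where "h j k = c * exp (- \<gamma> * real n) + 4 * c * \<delta> / \<gamma> * exp (- (\<gamma> / 4) * real (circ_dist (2 * n) j k))"
        for j k
      have rows: "(\<Sum>k<2 * n. h j k) \<le> f_min f / 4" if "j < 2 * n" for j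
      proof -
        have "(\<Sum>k<2 * n. h j k) = 2 * c * (real n * exp (- \<gamma> * real n)) +
            4 * c * \<delta> / \<gamma> * (\<Sum>k<2 * n. exp (- (\<gamma> / 4) * real (circ_dist (2 * n) j k)))"
          by (simp add: h_def sum.distrib sum_distrib_left)
        also have "\<dots> \<le> 2 * c * (real n * exp (- \<gamma> * real n)) + 4 * c * \<delta> / \<gamma> * (4 * G4)"
          unfolding G4_def using c_nonneg \<delta> gamma_pos
          by (intro add_left_mono mult_left_mono sum_circ_dist_le[OF summable _ that]) auto
        also have "4 * c * \<delta> / \<gamma> * (4 * G4) = \<delta> * B" by (simp add: B_def)
        also have "exp (- \<gamma> * real n) = 1 / exp \<gamma> ^ n"
          by (simp add: exp_of_nat_mult[symmetric] exp_minus divide_inverse mult.commute)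
        finally show ?thesis using n1[of n] n \<delta>B by simp
      qed
      have diff: "cmod (qform (2 * n) (\<lambda>j k. ?W j k - embed n 0 j k) u) \<le> f_min f / 4 * sqnorm (2 * n) u"
      proof (rule schur_test[where h = h])
        show "cmod (?W j k - embed n 0 j k) \<le> h j k" if "j < 2 * n" "k < 2 * n" for j k
          unfolding h_def by (rule weighted_entry_bound[OF b that \<delta>])
        show "(\<Sum>j<2 * n. h j k) \<le> f_min f / 4" if "k < 2 * n" for k
          using rows[OF that] by (simp add: h_def circ_dist_commute)
      qed (rule rows)
      \<comment> \<open>Averaging costs at most 1/8 of \<open>f_min f\<close>, corner and weight
        errors at most 1/8 each; the remaining 5/8 exceeds the required half.\<close>
      have "(f_min f - f_min f / 8) * sqnorm (2 * n) u \<le> (f_min f - 2 * c * G\<^sup>2 / real n) * sqnorm (2 * n) u"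
        using n1[of n] n by (intro mult_right_mono sqnorm_nonneg) auto
      also have "\<dots> \<le> Re (qform (2 * n) (embed n 0) u)"
        unfolding G_def using n1[of n] n by (intro embed_zero_coercive) simp
      also have "\<dots> = Re (qform (2 * n) ?W u) - Re (qform (2 * n) (\<lambda>j k. ?W j k - embed n 0 j k) u)"
        unfolding qform_diff[symmetric] by simp
      also have "\<dots> \<le> Re (qform (2 * n) ?W u) + f_min f / 4 * sqnorm (2 * n) u"
        using diff abs_Re_le_cmod[of "qform (2 * n) (\<lambda>j k. ?W j k - embed n 0 j k) u"] by linarith
      finally have "f_min f * (5 / 8) * sqnorm (2 * n) u \<le> Re (qform (2 * n) ?W u)"
        by (simp add: algebra_simps)
      moreover have "f_min f / 2 * sqnorm (2 * n) u \<le> f_min f * (5 / 8) * sqnorm (2 * n) u"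
        using f_min_pos by (intro mult_right_mono sqnorm_nonneg) auto
      ultimately show "f_min f / 2 * sqnorm (2 * n) u \<le> Re (qform (2 * n) ?W u)" by linarith
    qed
  qed (use \<delta> gamma_pos in auto)
qed

text \<open>The weighted vector \<open>v\<close> solves the conjugated system. Its right-hand side
  is bounded by \<open>c'\<close>, because \<delta> \<le> \<gamma> lets the decay of
  \<open>y\<close> compensate the weight. On the second half the weight equals \<open>n/2\<close>,
  so undoing it in the squared modulus gains \<open>exp (- \<delta> * real n)\<close>.\<close>

lemma embed_solution_decay:
  assumes \<delta>: "0 < \<delta>" "\<delta> \<le> \<gamma>" and b: "b \<in> {coeff (int n), 0}"
    and coer: "coercive_weight \<delta> n b"
    and y: "\<And>k. k < n \<Longrightarrow> cmod (y k) \<le> c' * exp (- \<gamma> * \<bar>real n / 2 - real k\<bar>)" and c': "0 \<le> c'"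
    and u: "\<And>j. j < 2 * n \<Longrightarrow> (\<Sum>k<2 * n. embed n b j k * u k) = (if j < n then y j else 0)"
    and l: "l < n"
  shows "(cmod (u (n + l)))\<^sup>2 \<le> 8 * real n * c'\<^sup>2 / (f_min f)\<^sup>2 * exp (- \<delta> * real n)"
proof -
  define v where "v j = of_real (exp (\<delta> * weight n j)) * u j" for j
  have "sqnorm (2 * n) v \<le> real (2 * n) * c'\<^sup>2 / (f_min f / 2)\<^sup>2"
  proof (rule coercive_solution_bound[OF _ coer[unfolded coercive_weight_def, rule_format]])
    fix j assume j: "j < 2 * n"
    have "(\<Sum>k<2 * n. embed n b j k * of_real (exp (\<delta> * (weight n j - weight n k))) * v k) =
       of_real (exp (\<delta> * weight n j)) * (\<Sum>k<2 * n. embed n b j k * u k)"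
      unfolding sum_distrib_left v_def
      by (intro sum.cong refl) (simp add: right_diff_distrib exp_diff)
    also have "\<dots> = of_real (exp (\<delta> * weight n j)) * (if j < n then y j else 0)"
      by (simp only: u[OF j])
    also have "cmod \<dots> \<le> c'"
    proof (cases "j < n")
      case True
      have "exp (\<delta> * weight n j) * cmod (y j) \<le>
          exp (\<gamma> * \<bar>real n / 2 - real j\<bar>) * (c' * exp (- \<gamma> * \<bar>real n / 2 - real j\<bar>))"
      proof (rule mult_mono)
        have "0 \<le> weight n j" "weight n j \<le> \<bar>real n / 2 - real j\<bar>" by (auto simp: weight_def)
        then have "\<delta> * weight n j \<le> \<gamma> * \<bar>real n / 2 - real j\<bar>"
          using \<delta> by (intro mult_mono) auto
        then show "exp (\<delta> * weight n j) \<le> exp (\<gamma> * \<bar>real n / 2 - real j\<bar>)" by simp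
      qed (use y True in auto)
      also have "\<dots> = c'" by (simp add: exp_minus)
      finally show ?thesis using True by (simp add: norm_mult)
    qed (use c' in simp)
    finally show "cmod (\<Sum>k<2 * n. embed n b j k * of_real (exp (\<delta> * (weight n j - weight n k))) * v k) \<le> c'" .
  qed (use f_min_pos in simp)
  moreover have "(cmod (v (n + l)))\<^sup>2 \<le> sqnorm (2 * n) v"
    unfolding sqnorm_def using l by (intro member_le_sum) auto
  moreover have "(cmod (v (n + l)))\<^sup>2 = exp (\<delta> * real n) * (cmod (u (n + l)))\<^sup>2"
  proof -
    have "weight n (n + l) = real n / 2" by (simp add: weight_def)
    then show ?thesis
      by (simp add: v_def norm_mult power_mult_distrib exp_double[symmetric])
  qed
  ultimately have le: "exp (\<delta> * real n) * (cmod (u (n + l)))\<^sup>2 \<le> 8 * real n * c'\<^sup>2 / (f_min f)\<^sup>2"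
    by (simp add: power_divide)
  have "(cmod (u (n + l)))\<^sup>2 = exp (- \<delta> * real n) * (exp (\<delta> * real n) * (cmod (u (n + l)))\<^sup>2)"
    by (simp add: exp_minus)
  also have "\<dots> \<le> exp (- \<delta> * real n) * (8 * real n * c'\<^sup>2 / (f_min f)\<^sup>2)"
    by (intro mult_left_mono le) simp
  finally show ?thesis by (simp only: mult.commute)
qed

text \<open>Hypothesis \<open>e\<close> is the equation \<open>A e = B\<^sup>* w\<close>, with
  \<open>w\<close> the second half of \<open>u\<close>. Its right-hand side inherits the decay of
  \<open>w\<close>, and the coercivity of the Toeplitz section transfers it to
  \<open>e\<close>.\<close>

lemma section_difference_bound:
  assumes \<delta>: "0 < \<delta>" "\<delta> \<le> \<gamma>" and b: "b \<in> {coeff (int n), 0}"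
    and coer: "coercive_weight \<delta> n b"
    and y: "\<And>k. k < n \<Longrightarrow> cmod (y k) \<le> c' * exp (- \<gamma> * \<bar>real n / 2 - real k\<bar>)" and c': "0 \<le> c'"
    and u: "\<And>j. j < 2 * n \<Longrightarrow> (\<Sum>k<2 * n. embed n b j k * u k) = (if j < n then y j else 0)"
    and e: "\<And>j. j < n \<Longrightarrow> (\<Sum>k<n. coeff (int j - int k) * e k) = (\<Sum>l<n. embed n b j (n + l) * u (n + l))"
  shows "L2_set (cmod \<circ> e) {..<n} \<le> 96 * c * c' / ((f_min f)\<^sup>2 * \<delta>\<^sup>2) * exp (- (\<delta> / 4) * real n)"
proof -
  define W where "W = sqrt (8 * real n * c'\<^sup>2 / (f_min f)\<^sup>2 * exp (- \<delta> * real n))"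
  have W2: "W\<^sup>2 = 8 * real n * c'\<^sup>2 / (f_min f)\<^sup>2 * exp (- \<delta> * real n)"
    by (simp add: W_def)
  have W: "cmod (u (n + l)) \<le> W" if "l < n" for l
    unfolding W_def using embed_solution_decay[OF \<delta> b coer y c' u that] by (intro real_le_rsqrt)
  have "sqnorm n e \<le> real n * (real n * (c * W))\<^sup>2 / (f_min f)\<^sup>2"
  proof (rule coercive_solution_bound[OF f_min_pos toeplitz_coercive[OF cont per]])
    fix j assume j: "j < n"
    have "cmod (\<Sum>k<n. coeff (int j - int k) * e k) \<le> (\<Sum>l<n. cmod (embed n b j (n + l) * u (n + l)))"
      unfolding e[OF j] by (rule norm_sum)
    also have "\<dots> \<le> (\<Sum>l<n. c * W)"
    proof (intro sum_mono)
      fix l assume "l \<in> {..<n}"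
      then have l: "l < n" by simp
      have "cmod (embed n b j (n + l)) \<le> c * exp (- \<gamma> * real (circ_dist (2 * n) j (n + l)))"
        using j l by (intro circulant_embedding_bound decay c_nonneg b) auto
      also have "\<dots> \<le> c * 1" using gamma_pos c_nonneg by (intro mult_left_mono) auto
      finally show "cmod (embed n b j (n + l) * u (n + l)) \<le> c * W"
        using W[OF l] c_nonneg by (simp add: norm_mult mult_mono)
    qed
    finally show "cmod (\<Sum>k<n. coeff (int j - int k) * e k) \<le> real n * (c * W)" by simp
  qed
  also have "\<dots> = 8 * c\<^sup>2 * c'\<^sup>2 / (f_min f) ^ 4 * (real n ^ 4 * exp (- \<delta> * real n))"
    by (simp only: power_mult_distrib W2) (simp add: power2_eq_square power4_eq_xxxx mult_ac)
  also have "\<dots> \<le> 8 * c\<^sup>2 * c'\<^sup>2 / (f_min f) ^ 4 * ((32 / \<delta>\<^sup>2)\<^sup>2 * exp (- (\<delta> / 2) * real n))"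
  proof (rule mult_left_mono)
    \<comment> \<open>Half of the exponential absorbs the power of \<open>n\<close>: the quadratic
      Taylor bound at \<open>\<delta> / 4 * real n\<close>, squared, dominates its fourth
      power.\<close>
    have "0 \<le> \<delta> / 4 * real n" using \<delta> by simp
    then have "(\<delta> / 4 * real n)\<^sup>2 / 2 \<le> exp (\<delta> / 4 * real n)"
      using exp_lower_Taylor_quadratic[of "\<delta> / 4 * real n"] by linarith
    then have "(real n)\<^sup>2 \<le> 32 / \<delta>\<^sup>2 * exp (\<delta> / 4 * real n)"
      using \<delta> by (simp add: field_simps)
    then have "((real n)\<^sup>2)\<^sup>2 \<le> (32 / \<delta>\<^sup>2 * exp (\<delta> / 4 * real n))\<^sup>2"
      by (intro power_mono) auto
    then have "real n ^ 4 \<le> (32 / \<delta>\<^sup>2)\<^sup>2 * exp (\<delta> / 2 * real n)"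
      by (simp only: power_mult_distrib) (simp flip: exp_double power_mult)
    then have "real n ^ 4 * exp (- \<delta> * real n) \<le> (32 / \<delta>\<^sup>2)\<^sup>2 * exp (\<delta> / 2 * real n) * exp (- \<delta> * real n)"
      by (intro mult_right_mono) auto
    also have "\<dots> = (32 / \<delta>\<^sup>2)\<^sup>2 * exp (- (\<delta> / 2) * real n)"
      by (simp add: mult.assoc flip: exp_add)
    finally show "real n ^ 4 * exp (- \<delta> * real n) \<le> (32 / \<delta>\<^sup>2)\<^sup>2 * exp (- (\<delta> / 2) * real n)" .
  qed simp
  also have "\<dots> \<le> (96 * c * c' / ((f_min f)\<^sup>2 * \<delta>\<^sup>2) * exp (- (\<delta> / 4) * real n))\<^sup>2"
  proof -
    have "(exp (- (\<delta> / 4) * real n))\<^sup>2 = exp (- (\<delta> / 2) * real n)"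
      by (simp flip: exp_double)
    then have "8 * c\<^sup>2 * c'\<^sup>2 / (f_min f) ^ 4 * ((32 / \<delta>\<^sup>2)\<^sup>2 * exp (- (\<delta> / 2) * real n)) =
        8 * c\<^sup>2 * c'\<^sup>2 / (f_min f) ^ 4 * (32 / \<delta>\<^sup>2)\<^sup>2 * (exp (- (\<delta> / 4) * real n))\<^sup>2"
      by (simp only: mult.assoc[of _ _ "_ ^ 2"])
    \<comment> \<open>Numerically \<open>8 * 32\<^sup>2 = 8192\<close> is at most
      \<open>96\<^sup>2 = 9216\<close>.\<close>
    also have "\<dots> \<le> (96 * c * c' / ((f_min f)\<^sup>2 * \<delta>\<^sup>2))\<^sup>2 * (exp (- (\<delta> / 4) * real n))\<^sup>2"
      by (intro mult_right_mono)
        (simp_all add: power_mult_distrib power_divide divide_right_mono flip: power_mult)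
    also have "\<dots> = (96 * c * c' / ((f_min f)\<^sup>2 * \<delta>\<^sup>2) * exp (- (\<delta> / 4) * real n))\<^sup>2"
      by (rule power_mult_distrib[symmetric])
    finally show ?thesis .
  qed
  finally show ?thesis
    unfolding L2_set_def sqnorm_def using c_nonneg c' by (intro real_le_lsqrt) (auto intro: sum_nonneg)
qed

end

section \<open>The compressed inverse and its linear system\<close>

lemma sum_lessThan_add:
  fixes g :: "nat \<Rightarrow> 'a :: comm_monoid_add"
  shows "(\<Sum>k<n + m. g k) = (\<Sum>k<n. g k) + (\<Sum>l<m. g (n + l))"
  by (induction m) (simp_all add: add.assoc)

lemma mult_mat_vec_index:
  assumes "A \<in> carrier_mat n m" "v \<in> carrier_vec m" "i < n"
  shows "(A *\<^sub>v v) $ i = (\<Sum>k<m. A $$ (i, k) * v $ k)"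
  using assms by (simp add: scalar_prod_def lessThan_atLeast0)

lemma invertible_mat_kernel_trivial:
  fixes A :: "'a :: field mat"
  assumes A: "A \<in> carrier_mat n n"
    and inj: "\<And>v. v \<in> carrier_vec n \<Longrightarrow> A *\<^sub>v v = 0\<^sub>v n \<Longrightarrow> v = 0\<^sub>v n"
  shows "invertible_mat A"
proof -
  have "det A \<noteq> 0" using det_0_iff_vec_prod_zero_field[OF A] inj by blast
  from det_non_zero_imp_unit[OF A this, of "()"] obtain B
    where "B \<in> carrier_mat n n" "A * B = 1\<^sub>m n" "B * A = 1\<^sub>m n"
    by (auto simp: Units_def ring_mat_def)
  then show ?thesis using A by (auto simp: invertible_mat_def inverts_mat_def)
qed

context decaying_symbol
begin

abbreviation compressed_inverse :: "nat \<Rightarrow> complex \<Rightarrow> complex mat" where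
  "compressed_inverse n b \<equiv> leading_principal n (inv_mat (circulant_embedding coeff n b))"

text \<open>\<open>u\<close> is the inverse of the embedding applied to \<open>y\<close> padded with
  zeros. Its first half is the compressed inverse applied to \<open>y\<close>; its second half is
  the vector shown to decay.\<close>

lemma padded_solution:
  assumes inv: "invertible_mat (circulant_embedding coeff n b)" and y: "y \<in> carrier_vec n"
  shows "\<exists>u. (\<forall>k<n. u k = (compressed_inverse n b *\<^sub>v y) $ k) \<and>
    (\<forall>j<2 * n. (\<Sum>k<2 * n. embed n b j k * u k) = (if j < n then y $ j else 0))"
proof -
  let ?C = "circulant_embedding coeff n b"
  define w where "w = vec (2 * n) (\<lambda>j. if j < n then y $ j else 0)"
  have C: "?C \<in> carrier_mat (2 * n) (2 * n)" by (rule circulant_embedding_carrier)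
  note Ci = inv_mat[OF C inv]
  have w: "w \<in> carrier_vec (2 * n)" by (simp add: w_def)
  show ?thesis
  proof (intro exI[of _ "\<lambda>k. (inv_mat ?C *\<^sub>v w) $ k"] conjI allI impI)
    fix k assume k: "k < n"
    then have "(inv_mat ?C *\<^sub>v w) $ k = (\<Sum>l<n + n. inv_mat ?C $$ (k, l) * w $ l)"
      using mult_mat_vec_index[OF Ci(1) w, of k] by (simp add: mult_2)
    also have "\<dots> = (\<Sum>l<n. inv_mat ?C $$ (k, l) * y $ l)"
      unfolding sum_lessThan_add by (simp add: w_def)
    also have "\<dots> = (compressed_inverse n b *\<^sub>v y) $ k"
      using k y by (subst mult_mat_vec_index[of _ n n]) (auto simp: leading_principal_def)
    finally show "(inv_mat ?C *\<^sub>v w) $ k = (compressed_inverse n b *\<^sub>v y) $ k" .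
  next
    fix j assume j: "j < 2 * n"
    have "?C *\<^sub>v (inv_mat ?C *\<^sub>v w) = w"
      using Ci C w by (simp flip: assoc_mult_mat_vec)
    then show "(\<Sum>k<2 * n. embed n b j k * (inv_mat ?C *\<^sub>v w) $ k) = (if j < n then y $ j else 0)"
      using mult_mat_vec_index[OF C _ j, of "inv_mat ?C *\<^sub>v w"] Ci(1) w j
      by (simp add: w_def)
  qed
qed

text \<open>If \<open>v\<close> is in the kernel, the padded solution vanishes on its first half.
  The lower block row then says that the Toeplitz section annihilates the second half, so this
  vanishes by coercivity, and the upper block row gives \<open>v = 0\<close>. This makes
  \<open>S_mat\<close> a genuine inverse.\<close>

lemma compressed_inverse_invertible:
  assumes inv: "invertible_mat (circulant_embedding coeff n b)"
  shows "invertible_mat (compressed_inverse n b)"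
proof (rule invertible_mat_kernel_trivial[where n = n])
  fix v :: "complex vec" assume v: "v \<in> carrier_vec n" "compressed_inverse n b *\<^sub>v v = 0\<^sub>v n"
  from padded_solution[OF inv v(1)] obtain u
    where "\<forall>k<n. u k = (compressed_inverse n b *\<^sub>v v) $ k"
      "\<forall>j<2 * n. (\<Sum>k<2 * n. embed n b j k * u k) = (if j < n then v $ j else 0)"
    by (elim exE conjE)
  note u = this[rule_format]
  have u0: "u k = 0" if "k < n" for k using u(1)[OF that] v(2) that by simp
  have split: "(\<Sum>k<2 * n. embed n b j k * u k) = (\<Sum>l<n. embed n b j (n + l) * u (n + l))" for j
    unfolding mult_2 sum_lessThan_add by (simp add: u0)
  have "sqnorm n (\<lambda>l. u (n + l)) \<le> real n * 0\<^sup>2 / (f_min f)\<^sup>2"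
  proof (rule coercive_solution_bound[OF f_min_pos toeplitz_coercive[OF cont per]])
    fix j assume j: "j < n"
    have "(\<Sum>k<n. coeff (int j - int k) * u (n + k)) = (\<Sum>l<n. embed n b (n + j) (n + l) * u (n + l))"
      using j by (intro sum.cong refl) (simp add: circulant_embedding_index)
    then show "cmod (\<Sum>k<n. coeff (int j - int k) * u (n + k)) \<le> 0"
      using u(2)[of "n + j"] split[of "n + j"] j by simp
  qed
  then have "sqnorm n (\<lambda>l. u (n + l)) = 0" using sqnorm_nonneg[of n "\<lambda>l. u (n + l)"] by simp
  then have "u (n + l) = 0" if "l < n" for l
    using that by (simp add: sqnorm_def sum_nonneg_eq_0_iff)
  then have "v $ j = 0" if "j < n" for j
    using u(2)[of j] split[of j] that by simp
  then show "v = 0\<^sub>v n" using v(1) by auto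
qed (simp add: leading_principal_def)

lemma S_mat_solution:
  assumes inv: "invertible_mat (circulant_embedding coeff n b)" and z: "z \<in> carrier_vec n"
    and S: "S_mat coeff n b *\<^sub>v z = y"
  shows "z = compressed_inverse n b *\<^sub>v y"
proof -
  have M: "compressed_inverse n b \<in> carrier_mat n n" by (simp add: leading_principal_def)
  note Mi = inv_mat[OF M compressed_inverse_invertible[OF inv]]
  show ?thesis unfolding S[symmetric] S_mat_def using M Mi z by (simp flip: assoc_mult_mat_vec)
qed

section \<open>Bounds for the difference of the two solutions\<close>

text \<open>Bundles conditions on the data of a single \<open>n\<close>, whereas the locale fixes
  the symbol.\<close>

definition admissible :: "real \<Rightarrow> nat \<Rightarrow> complex \<Rightarrow> complex vec \<Rightarrow> complex vec \<Rightarrow> complex vec \<Rightarrow> bool" where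
  "admissible c' n b x y z \<longleftrightarrow>
     x \<in> carrier_vec n \<and> y \<in> carrier_vec n \<and> z \<in> carrier_vec n \<and>
     (\<forall>k<n. cmod (y $ k) \<le> c' * exp (- \<gamma> * \<bar>real n / 2 - real k\<bar>)) \<and>
     toeplitz_mat coeff n *\<^sub>v x = y \<and> invertible_mat (circulant_embedding coeff n b) \<and>
     S_mat coeff n b *\<^sub>v z = y"

lemma admissible_row:
  assumes "admissible c' n b x y z" "j < n"
  shows "(\<Sum>k<n. coeff (int j - int k) * x $ k) = y $ j"
proof -
  have "y $ j = (toeplitz_mat coeff n *\<^sub>v x) $ j" using assms by (simp add: admissible_def)
  also have "\<dots> = (\<Sum>k<n. coeff (int j - int k) * x $ k)"
    using assms by (subst mult_mat_vec_index[of _ n n]) (auto simp: admissible_def toeplitz_mat_def)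
  finally show ?thesis by simp
qed

lemma difference_bound_large_n:
  "\<exists>\<delta> n0 K. 0 < \<delta> \<and> 0 \<le> K \<and>
    (\<forall>n b x y z. n0 \<le> n \<longrightarrow> b \<in> {coeff (int n), 0} \<longrightarrow> admissible c' n b x y z \<longrightarrow>
      vec_norm2 (x - z) \<le> K * exp (- \<delta> * real n))"
proof -
  from coercive_weight_exists obtain \<delta> n0 where \<delta>: "0 < \<delta>" "\<delta> \<le> \<gamma>" and
    coer: "\<forall>n b. n0 \<le> n \<longrightarrow> b \<in> {coeff (int n), 0} \<longrightarrow> coercive_weight \<delta> n b"
    by (elim exE conjE)
  \<comment> \<open>The sign of \<open>c'\<close> is unrestricted, hence the absolute value.\<close>
  define K where "K = 96 * c * \<bar>c'\<bar> / ((f_min f)\<^sup>2 * \<delta>\<^sup>2)"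
  show ?thesis
  proof (rule exI[of _ "\<delta> / 4"], rule exI[of _ n0], rule exI[of _ K], intro conjI allI impI)
    fix n b and x y z :: "complex vec"
    assume n: "n0 \<le> n" and b: "b \<in> {coeff (int n), 0}" and adm: "admissible c' n b x y z"
    from adm have x: "x \<in> carrier_vec n" and y: "y \<in> carrier_vec n" and z: "z \<in> carrier_vec n"
      and y_bound: "\<And>k. k < n \<Longrightarrow> cmod (y $ k) \<le> c' * exp (- \<gamma> * \<bar>real n / 2 - real k\<bar>)"
      and inv: "invertible_mat (circulant_embedding coeff n b)"
      and S: "S_mat coeff n b *\<^sub>v z = y"
      unfolding admissible_def by auto
    from padded_solution[OF inv y] obtain u
      where "\<forall>k<n. u k = z $ k"
        "\<forall>j<2 * n. (\<Sum>k<2 * n. embed n b j k * u k) = (if j < n then y $ j else 0)"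
      unfolding S_mat_solution[OF inv z S, symmetric] by (elim exE conjE)
    note u = this[rule_format]
    have "L2_set (cmod \<circ> (\<lambda>k. (x - z) $ k)) {..<n} \<le> K * exp (- (\<delta> / 4) * real n)"
      unfolding K_def
    proof (rule section_difference_bound[OF \<delta> b coer[rule_format, OF n b],
          where y = "\<lambda>k. y $ k" and u = u and e = "\<lambda>k. (x - z) $ k"])
      fix k assume "k < n"
      from y_bound[OF this] show "cmod (y $ k) \<le> \<bar>c'\<bar> * exp (- \<gamma> * \<bar>real n / 2 - real k\<bar>)"
        by (rule order.trans) (simp add: mult_right_mono)
    next
      fix j assume j: "j < n"
      \<comment> \<open>The upper block row of the padded system has the same right-hand side as the
        system for \<open>x\<close>; subtracting the part with \<open>z\<close> leaves the corner
        block applied to the second half of \<open>u\<close>.\<close>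
      have "(\<Sum>k<n. coeff (int j - int k) * x $ k) = (\<Sum>k<n + n. embed n b j k * u k)"
        using u(2)[of j] j admissible_row[OF adm j] by (simp only: mult_2 if_True)
      also have "\<dots> = (\<Sum>k<n. embed n b j k * u k) + (\<Sum>l<n. embed n b j (n + l) * u (n + l))"
        by (rule sum_lessThan_add)
      also have "(\<Sum>k<n. embed n b j k * u k) = (\<Sum>k<n. coeff (int j - int k) * z $ k)"
        using j u(1) by (intro sum.cong refl) (simp add: circulant_embedding_index)
      finally have "(\<Sum>k<n. coeff (int j - int k) * x $ k) - (\<Sum>k<n. coeff (int j - int k) * z $ k) =
          (\<Sum>l<n. embed n b j (n + l) * u (n + l))"
        by simp
      then show "(\<Sum>k<n. coeff (int j - int k) * (x - z) $ k) = (\<Sum>l<n. embed n b j (n + l) * u (n + l))"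
        using x z by (simp add: right_diff_distrib sum_subtractf)
    qed (use u(2) in auto)
    then show "vec_norm2 (x - z) \<le> K * exp (- (\<delta> / 4) * real n)"
      using x z by (simp add: vec_norm2_def o_def)
  qed (use \<delta> c_nonneg in \<open>auto simp: K_def\<close>)
qed

text \<open>\<open>x\<close> is controlled by coercivity of the Toeplitz section, \<open>z\<close>
  by the entries of the compressed inverse. The bound depends on \<open>n\<close> and
  \<open>b\<close> but not on the vectors.\<close>

lemma difference_bound_fixed_n:
  "\<exists>K\<ge>0. \<forall>x y z. admissible c' n b x y z \<longrightarrow> vec_norm2 (x - z) \<le> K"
proof -
  define X where "X = sqrt (real n * c'\<^sup>2 / (f_min f)\<^sup>2)"
  define K where "K = (\<Sum>k<n. X + (\<Sum>l<n. cmod (compressed_inverse n b $$ (k, l)) * \<bar>c'\<bar>))"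
  show ?thesis
  proof (intro exI[of _ K] conjI allI impI)
    show "0 \<le> K" by (auto simp: K_def X_def intro!: sum_nonneg add_nonneg_nonneg)
    fix x y z :: "complex vec"
    assume adm: "admissible c' n b x y z"
    then have x: "x \<in> carrier_vec n" and y: "y \<in> carrier_vec n" and z: "z \<in> carrier_vec n"
      and y_bound: "\<And>k. k < n \<Longrightarrow> cmod (y $ k) \<le> c' * exp (- \<gamma> * \<bar>real n / 2 - real k\<bar>)"
      and inv: "invertible_mat (circulant_embedding coeff n b)"
      and S: "S_mat coeff n b *\<^sub>v z = y"
      unfolding admissible_def by auto
    have y': "cmod (y $ k) \<le> \<bar>c'\<bar>" if "k < n" for k
    proof -
      have "c' * exp (- \<gamma> * \<bar>real n / 2 - real k\<bar>) \<le> \<bar>c'\<bar> * 1"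
        using gamma_pos by (intro mult_mono) auto
      then show ?thesis using y_bound[OF that] by simp
    qed
    have "sqnorm n (\<lambda>k. x $ k) \<le> real n * \<bar>c'\<bar>\<^sup>2 / (f_min f)\<^sup>2"
    proof (rule coercive_solution_bound[OF f_min_pos toeplitz_coercive[OF cont per]])
      fix j assume j: "j < n"
      show "cmod (\<Sum>k<n. coeff (int j - int k) * x $ k) \<le> \<bar>c'\<bar>"
        using y'[OF j] admissible_row[OF adm j] by simp
    qed
    moreover have "(cmod (x $ k))\<^sup>2 \<le> sqnorm n (\<lambda>k. x $ k)" if "k < n" for k
      unfolding sqnorm_def using that by (intro member_le_sum) auto
    ultimately have x_bound: "cmod (x $ k) \<le> X" if "k < n" for k
      unfolding X_def using that by (intro real_le_rsqrt) (fastforce intro: order.trans)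
    have z_bound: "cmod (z $ k) \<le> (\<Sum>l<n. cmod (compressed_inverse n b $$ (k, l)) * \<bar>c'\<bar>)" if k: "k < n" for k
    proof -
      have "z $ k = (\<Sum>l<n. compressed_inverse n b $$ (k, l) * y $ l)"
        using k y by (subst S_mat_solution[OF inv z S], subst mult_mat_vec_index[of _ n n])
          (auto simp: leading_principal_def)
      also have "cmod \<dots> \<le> (\<Sum>l<n. cmod (compressed_inverse n b $$ (k, l)) * \<bar>c'\<bar>)"
        by (intro order.trans[OF norm_sum] sum_mono) (simp add: norm_mult mult_left_mono y')
      finally show ?thesis .
    qed
    have "dim_vec (x - z) = n" using z by simp
    then have "vec_norm2 (x - z) \<le> (\<Sum>k<n. cmod ((x - z) $ k))"
      by (simp only: vec_norm2_def L2_set_le_sum norm_ge_zero)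
    also have "\<dots> \<le> K"
      unfolding K_def
    proof (rule sum_mono)
      fix k assume "k \<in> {..<n}"
      then have k: "k < n" by simp
      then have "cmod ((x - z) $ k) \<le> cmod (x $ k) + cmod (z $ k)"
        using x z norm_triangle_ineq4 by simp
      then show "cmod ((x - z) $ k) \<le> X + (\<Sum>l<n. cmod (compressed_inverse n b $$ (k, l)) * \<bar>c'\<bar>)"
        using x_bound[OF k] z_bound[OF k] by linarith
    qed
    finally show "vec_norm2 (x - z) \<le> K" .
  qed
qed

lemma difference_bound:
  "\<exists>\<delta> K. 0 < \<delta> \<and> 0 \<le> K \<and>
    (\<forall>n b x y z. b \<in> {coeff (int n), 0} \<longrightarrow> admissible c' n b x y z \<longrightarrow>
      vec_norm2 (x - z) \<le> K * exp (- \<delta> * real n))"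
proof -
  from difference_bound_large_n[of c'] obtain \<delta> n0 K1 where \<delta>: "0 < \<delta>" and K1: "0 \<le> K1"
    and large: "\<forall>n b x y z. n0 \<le> n \<longrightarrow> b \<in> {coeff (int n), 0} \<longrightarrow> admissible c' n b x y z \<longrightarrow>
      vec_norm2 (x - z) \<le> K1 * exp (- \<delta> * real n)"
    by (elim exE conjE)
  have "\<forall>n b. \<exists>K\<ge>0. \<forall>x y z. admissible c' n b x y z \<longrightarrow> vec_norm2 (x - z) \<le> K"
    by (intro allI difference_bound_fixed_n)
  then obtain K2 where K2: "\<And>n b. 0 \<le> K2 n b"
    and small: "\<And>n b x y z. admissible c' n b x y z \<Longrightarrow> vec_norm2 (x - z) \<le> K2 n b"
    by metis
  \<comment> \<open>Below \<open>n0\<close> only finitely many pairs of \<open>n\<close> and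
    \<open>b\<close> occur, and the sum dominates each of their bounds. The factor
    \<open>exp (\<delta> * real n0)\<close> in \<open>K\<close> offsets the decay demanded
    there.\<close>
  define K3 where "K3 = (\<Sum>n<n0. \<Sum>b\<in>{coeff (int n), 0}. K2 n b)"
  have K3: "0 \<le> K3" unfolding K3_def by (intro sum_nonneg K2)
  define K where "K = K1 + K3 * exp (\<delta> * real n0)"
  have main: "vec_norm2 (x - z) \<le> K * exp (- \<delta> * real n)"
    if b: "b \<in> {coeff (int n), 0}" and adm: "admissible c' n b x y z" for n b x y z
  proof (cases "n0 \<le> n")
    case True
    from large[rule_format, OF this b adm] have "vec_norm2 (x - z) \<le> K1 * exp (- \<delta> * real n)" .
    also have "\<dots> \<le> K * exp (- \<delta> * real n)" using K3 by (intro mult_right_mono) (auto simp: K_def)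
    finally show ?thesis .
  next
    case False
    have "vec_norm2 (x - z) \<le> K2 n b" by (rule small[OF adm])
    also have "\<dots> \<le> (\<Sum>b\<in>{coeff (int n), 0}. K2 n b)"
      using b K2 by (intro member_le_sum) auto
    also have "\<dots> \<le> K3"
      unfolding K3_def using False K2 by (intro member_le_sum sum_nonneg) auto
    also have "\<dots> \<le> K3 * (exp (\<delta> * real n0) * exp (- \<delta> * real n))"
    proof -
      have "1 \<le> exp (\<delta> * real n0) * exp (- \<delta> * real n)"
        using False \<delta> by (simp flip: exp_add)
      then show ?thesis using K3 by (simp add: mult_le_cancel_left1)
    qed
    also have "\<dots> \<le> K * exp (- \<delta> * real n)" using K1 by (simp add: K_def distrib_right)
    finally show ?thesis .
  qed
  have "0 \<le> K" using K1 K3 by (simp add: K_def)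
  show ?thesis
    by (rule exI[of _ \<delta>], rule exI[of _ K]) (use \<delta> main \<open>0 \<le> K\<close> in blast)
qed

end

section \<open>Choice of the rate and the constant\<close>

theorem theorem4p1:
  shows "\<exists>c1 :: real \<Rightarrow> real \<Rightarrow> real \<Rightarrow> real.
    \<forall>(f :: real \<Rightarrow> real) (\<gamma> :: real) (c :: real) (c' :: real).
      continuous_on UNIV f \<and> (\<forall>\<omega>. f (\<omega> + 1) = f \<omega>) \<and> 0 < f_min f \<and> 0 < \<gamma> \<and>
      (\<forall>k :: int. cmod (toeplitz_coeff f k) \<le> c * exp (- \<gamma> * \<bar>real_of_int k\<bar>)) \<longrightarrow>
      (\<exists>\<gamma>1. 0 < \<gamma>1 \<and> \<gamma>1 < \<gamma> \<and>
        (\<forall>(n :: nat) (b0 :: complex) (x :: complex vec) (y :: complex vec) (z :: complex vec).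
          1 \<le> n \<and> b0 \<in> {toeplitz_coeff f (int n), 0} \<and>
          x \<in> carrier_vec n \<and> y \<in> carrier_vec n \<and> z \<in> carrier_vec n \<and>
          hermitian_pos_def (toeplitz_mat (toeplitz_coeff f) n) \<and>
          (\<forall>k<n. cmod (y $ k) \<le> c' * exp (- \<gamma> * \<bar>real n / 2 - real k\<bar>)) \<and>
          toeplitz_mat (toeplitz_coeff f) n *\<^sub>v x = y \<and>
          invertible_mat (circulant_embedding (toeplitz_coeff f) n b0) \<and>
          S_mat (toeplitz_coeff f) n b0 *\<^sub>v z = y \<longrightarrow>
          vec_norm2 (x - z) \<le> c1 (f_min f) (f_max f) \<gamma>1 * exp (- \<gamma>1 * real n)))"
proof (rule exI[of _ "\<lambda>_ _ \<gamma>1. 1 / \<gamma>1"], intro allI impI)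
  fix f :: "real \<Rightarrow> real" and \<gamma> c c' :: real
  assume "continuous_on UNIV f \<and> (\<forall>\<omega>. f (\<omega> + 1) = f \<omega>) \<and> 0 < f_min f \<and> 0 < \<gamma> \<and>
      (\<forall>k :: int. cmod (toeplitz_coeff f k) \<le> c * exp (- \<gamma> * \<bar>real_of_int k\<bar>))"
  then interpret decaying_symbol f \<gamma> c by unfold_locales auto
  from difference_bound[of c'] obtain \<delta> K where \<delta>: "0 < \<delta>" and K: "0 \<le> K" and
    bound: "\<forall>n b x y z. b \<in> {coeff (int n), 0} \<longrightarrow> admissible c' n b x y z \<longrightarrow>
      vec_norm2 (x - z) \<le> K * exp (- \<delta> * real n)"
    by (elim exE conjE)
  \<comment> \<open>\<open>\<delta>\<close> serves the comparison of the exponentials,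
    \<open>\<gamma> / 2\<close> the strict inequality with \<gamma>, and \<open>1 / (K + 1)\<close>
    the bound \<open>K \<le> 1 / \<gamma>1\<close>; adding 1 covers \<open>K = 0\<close>.\<close>
  define \<gamma>1 where "\<gamma>1 = min (min \<delta> (\<gamma> / 2)) (1 / (K + 1))"
  have \<gamma>1: "0 < \<gamma>1" "\<gamma>1 < \<gamma>" "\<gamma>1 \<le> \<delta>" "\<gamma>1 \<le> 1 / (K + 1)"
    using \<delta> K gamma_pos by (auto simp: \<gamma>1_def min_less_iff_disj)
  have le: "K * exp (- \<delta> * real n) \<le> 1 / \<gamma>1 * exp (- \<gamma>1 * real n)" for n
  proof (rule mult_mono)
    have "\<gamma>1 * (K + 1) \<le> 1" using \<gamma>1(4) K by (simp add: pos_le_divide_eq)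
    then show "K \<le> 1 / \<gamma>1" using \<gamma>1(1) by (simp add: pos_le_divide_eq algebra_simps)
    show "exp (- \<delta> * real n) \<le> exp (- \<gamma>1 * real n)" using \<gamma>1(3) by (simp add: mult_right_mono)
  qed (use \<gamma>1 in auto)
  have main: "vec_norm2 (x - z) \<le> 1 / \<gamma>1 * exp (- \<gamma>1 * real n)"
    if "b \<in> {coeff (int n), 0}" "admissible c' n b x y z" for n b x y z
    by (rule order.trans[OF bound[rule_format, OF that] le])
  show "\<exists>\<gamma>1. 0 < \<gamma>1 \<and> \<gamma>1 < \<gamma> \<and>
        (\<forall>(n :: nat) (b0 :: complex) (x :: complex vec) (y :: complex vec) (z :: complex vec).
          1 \<le> n \<and> b0 \<in> {toeplitz_coeff f (int n), 0} \<and>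
          x \<in> carrier_vec n \<and> y \<in> carrier_vec n \<and> z \<in> carrier_vec n \<and>
          hermitian_pos_def (toeplitz_mat (toeplitz_coeff f) n) \<and>
          (\<forall>k<n. cmod (y $ k) \<le> c' * exp (- \<gamma> * \<bar>real n / 2 - real k\<bar>)) \<and>
          toeplitz_mat (toeplitz_coeff f) n *\<^sub>v x = y \<and>
          invertible_mat (circulant_embedding (toeplitz_coeff f) n b0) \<and>
          S_mat (toeplitz_coeff f) n b0 *\<^sub>v z = y \<longrightarrow>
          vec_norm2 (x - z) \<le> 1 / \<gamma>1 * exp (- \<gamma>1 * real n))"
    by (rule exI[of _ \<gamma>1]) (use \<gamma>1 main in \<open>unfold admissible_def, blast\<close>)
qed

end
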